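(* The convex roof of local randomness, $$BD_{J_A}(\rho_{AB})=\min_{\{p_e,|\Psi_{AB}\rangle_e\}}\sum_ep_eR(|\Psi_{AB}\rangle_e),$$ where the minimum is over all pure-state decompositions $\rho_{AB}=\sum_ep_e|\Psi_{AB}\rangle\langle\Psi_{AB}|_e$ and $$R(|\Psi_{AB}\rangle)=S\Big(\sum_{j_A}\langle j_A|\mathrm{tr}_B(|\Psi_{AB}\rangle\langle\Psi_{AB}|)|j_A\rangle\,|j_A\rangle\langle j_A|\Big)$$ with $S$ the von Neumann entropy, is a basis-dependent discord measure, i.e. it satisfies (BD1), (BD2) and (BD3).
   Context: $\mathcal H_A,\mathcal H_B$ are finite-dimensional complex Hilbert spaces; states are density operators; $J_A=\{|j_A\rangle\}_{j_A=1}^{d_A}$ is a fixed orthonormal basis of $\mathcal H_A$. Decompositions are finite, with $\{p_e\}$ a probability distribution and $|\Psi_{AB}\rangle_e$ unit vectors; the minimum is understood as an infimum if it is not attained. Incoherent states of $A$ are the states diagonal in $J_A$. An operator $K$ on $\mathcal H_A$ is an incoherent Kraus operator if $K\sigma K^\dagger$ is diagonal in $J_A$ for every incoherent $\sigma$; an incoherent unitary is a unitary that is an incoherent Kraus operator. Incoherent-quantum (IQ) states: $\sum_{j_A}p_{j_A}|j_A\rangle\langle j_A|\otimes\rho_B^{j_A}$ with $p$ a probability distribution and $\rho_B^{j_A}$ states of $B$. Separable-quantum-incoherent (SQI) operations: $\Lambda_{SQI}(\rho_{AB})=\sum_n(A_n\otimes B_n)\rho_{AB}(A_n\otimes B_n)^\dagger$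 with $\sum_nA_n^\dagger A_n\otimes B_n^\dagger B_n=I$, each $A_n$ an incoherent Kraus operator on $A$ and each $B_n$ an operator on $B$. The conditions are: (BD1) $BD_{J_A}$ vanishes on IQ states; (BD2) $BD_{J_A}(\Lambda_{SQI}(\rho_{AB}))\le BD_{J_A}(\rho_{AB})$ for all SQI operations; (BD3) $BD_{J_A}$ is invariant under conjugation by $U_A\otimes U_B$ with $U_A$ an incoherent unitary on $A$ and $U_B$ any unitary on $B$. *)

theory Defs
  imports "HOL-Analysis.Analysis"
begin

text \<open>
  The Hilbert spaces are \<open>complex ^ 'a\<close> and \<open>complex ^ 'b\<close> for arbitrary finite index types, and
  their tensor product is \<open>complex ^ ('a \<times> 'b)\<close>.  Operators are square matrices.
\<close>

type_synonym 'n op = "complex ^ 'n ^ 'n"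

text \<open>Conjugate-linear in the first argument.\<close>

definition braket :: "complex ^ 'n \<Rightarrow> complex ^ 'n \<Rightarrow> complex" where
  "braket v w = (\<Sum>i\<in>UNIV. cnj (v $ i) * w $ i)"

definition ketbra :: "complex ^ 'n \<Rightarrow> complex ^ 'n \<Rightarrow> 'n::finite op" where
  "ketbra v w = (\<chi> i j. v $ i * cnj (w $ j))"

definition dagger :: "'n::finite op \<Rightarrow> 'n op" where
  "dagger M = (\<chi> i j. cnj (M $ j $ i))"

definition unitary_op :: "'n::finite op \<Rightarrow> bool" where
  "unitary_op U \<longleftrightarrow> dagger U ** U = mat 1 \<and> U ** dagger U = mat 1"

definition density_op :: "'n::finite op \<Rightarrow> bool" where
  "density_op \<rho> \<longleftrightarrow>
     dagger \<rho> = \<rho> \<and> (\<forall>v. 0 \<le> Re (braket v (\<rho> *v v))) \<and> trace \<rho> = 1"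

definition tensor_op :: "'a::finite op \<Rightarrow> 'b::finite op \<Rightarrow> ('a \<times> 'b) op"
    (infixr "\<otimes>\<^sub>o" 75) where
  "M \<otimes>\<^sub>o N = (\<chi> i j. M $ fst i $ fst j * N $ snd i $ snd j)"

definition partial_trace_B :: "('a::finite \<times> 'b::finite) op \<Rightarrow> 'a op" where
  "partial_trace_B M = (\<chi> i j. \<Sum>k\<in>UNIV. M $ (i, k) $ (j, k))"

text \<open>
  As the index type of \<open>J\<close> is that of the coordinates, an orthonormal family is automatically
  a basis.
\<close>

definition orthonormal_basis :: "('a \<Rightarrow> complex ^ 'a) \<Rightarrow> bool" where
  "orthonormal_basis J \<longleftrightarrow> (\<forall>i j. braket (J i) (J j) = (if i = j then 1 else 0))"

definition diagonal_in :: "('a \<Rightarrow> complex ^ 'a) \<Rightarrow> 'a::finite op \<Rightarrow> bool" where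
  "diagonal_in J M \<longleftrightarrow> (\<forall>i j. i \<noteq> j \<longrightarrow> braket (J i) (M *v J j) = 0)"

definition incoherent_state :: "('a \<Rightarrow> complex ^ 'a) \<Rightarrow> 'a::finite op \<Rightarrow> bool" where
  "incoherent_state J \<sigma> \<longleftrightarrow> density_op \<sigma> \<and> diagonal_in J \<sigma>"

definition incoherent_kraus :: "('a \<Rightarrow> complex ^ 'a) \<Rightarrow> 'a::finite op \<Rightarrow> bool" where
  "incoherent_kraus J K \<longleftrightarrow>
     (\<forall>\<sigma>. incoherent_state J \<sigma> \<longrightarrow> diagonal_in J (K ** \<sigma> ** dagger K))"

definition incoherent_unitary :: "('a \<Rightarrow> complex ^ 'a) \<Rightarrow> 'a::finite op \<Rightarrow> bool" where
  "incoherent_unitary J U \<longleftrightarrow> unitary_op U \<and> incoherent_kraus J U"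

definition IQ_state :: "('a \<Rightarrow> complex ^ 'a) \<Rightarrow> ('a::finite \<times> 'b::finite) op \<Rightarrow> bool" where
  "IQ_state J \<rho> \<longleftrightarrow>
     (\<exists>(p :: 'a \<Rightarrow> real) (\<sigma> :: 'a \<Rightarrow> 'b op).
        (\<forall>j. 0 \<le> p j) \<and> (\<Sum>j\<in>UNIV. p j) = 1 \<and> (\<forall>j. density_op (\<sigma> j)) \<and>
        \<rho> = (\<Sum>j\<in>UNIV. p j *\<^sub>R (ketbra (J j) (J j) \<otimes>\<^sub>o \<sigma> j)))"

definition SQI_operation ::
    "('a \<Rightarrow> complex ^ 'a) \<Rightarrow> (('a::finite \<times> 'b::finite) op \<Rightarrow> ('a \<times> 'b) op) \<Rightarrow> bool" where
  "SQI_operation J \<Lambda> \<longleftrightarrow>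
     (\<exists>(N :: nat) (A :: nat \<Rightarrow> 'a op) (B :: nat \<Rightarrow> 'b op).
        (\<forall>n<N. incoherent_kraus J (A n)) \<and>
        (\<Sum>n<N. (dagger (A n) ** A n) \<otimes>\<^sub>o (dagger (B n) ** B n)) = mat 1 \<and>
        (\<forall>\<rho>. \<Lambda> \<rho> = (\<Sum>n<N. (A n \<otimes>\<^sub>o B n) ** \<rho> ** dagger (A n \<otimes>\<^sub>o B n))))"

definition eigenspace :: "'n::finite op \<Rightarrow> real \<Rightarrow> (complex ^ 'n) set" where
  "eigenspace M x = {v. M *v v = complex_of_real x *s v}"

text \<open>
  \<open>- tr (\<rho> log \<rho>)\<close> in bits, written as a sum over the distinct eigenvalues of the Hermitian
  matrix \<open>\<rho>\<close>, weighted with their multiplicities; \<open>vec.dim\<close> is the complex dimension.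
  The convention \<open>0 log 0 = 0\<close> is built in.
\<close>

definition von_neumann_entropy :: "'n::finite op \<Rightarrow> real" where
  "von_neumann_entropy \<rho> =
     - (\<Sum>x | eigenspace \<rho> x \<noteq> {0}. real (vec.dim (eigenspace \<rho> x)) * (x * log 2 x))"

text \<open>The factor \<open>mat c\<close> is multiplication by the scalar \<open>c\<close>.\<close>

definition dephase :: "('a \<Rightarrow> complex ^ 'a) \<Rightarrow> 'a::finite op \<Rightarrow> 'a op" where
  "dephase J M = (\<Sum>j\<in>UNIV. mat (braket (J j) (M *v J j)) ** ketbra (J j) (J j))"

definition local_randomness :: "('a \<Rightarrow> complex ^ 'a) \<Rightarrow> complex ^ ('a \<times> 'b::finite) \<Rightarrow> real" where
  "local_randomness J \<Psi> = von_neumann_entropy (dephase J (partial_trace_B (ketbra \<Psi> \<Psi>)))"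

definition pure_decomposition ::
    "'n::finite op \<Rightarrow> nat \<Rightarrow> (nat \<Rightarrow> real) \<Rightarrow> (nat \<Rightarrow> complex ^ 'n) \<Rightarrow> bool" where
  "pure_decomposition \<rho> N p \<Psi> \<longleftrightarrow>
     (\<forall>e<N. 0 \<le> p e) \<and> (\<Sum>e<N. p e) = 1 \<and> (\<forall>e<N. norm (\<Psi> e) = 1) \<and>
     \<rho> = (\<Sum>e<N. p e *\<^sub>R ketbra (\<Psi> e) (\<Psi> e))"

text \<open>
  Used for density operators only: these have a pure-state decomposition, and local randomness
  is nonnegative on unit vectors, so the infimum is over a nonempty set bounded below.
\<close>

definition BD :: "('a \<Rightarrow> complex ^ 'a) \<Rightarrow> ('a::finite \<times> 'b::finite) op \<Rightarrow> real" where
  "BD J \<rho> = Inf {(\<Sum>e<N. p e * local_randomness J (\<Psi> e)) | N p \<Psi>. pure_decomposition \<rho> N p \<Psi>}"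

definition basis_dependent_discord_measure ::
    "('a \<Rightarrow> complex ^ 'a) \<Rightarrow> (('a::finite \<times> 'b::finite) op \<Rightarrow> real) \<Rightarrow> bool" where
  "basis_dependent_discord_measure J D \<longleftrightarrow>
     (\<forall>\<rho>. IQ_state J \<rho> \<longrightarrow> D \<rho> = 0) \<and>
     (\<forall>\<Lambda> \<rho>. SQI_operation J \<Lambda> \<and> density_op \<rho> \<longrightarrow> D (\<Lambda> \<rho>) \<le> D \<rho>) \<and>
     (\<forall>U V \<rho>. incoherent_unitary J U \<and> unitary_op V \<and> density_op \<rho> \<longrightarrow>
        D ((U \<otimes>\<^sub>o V) ** \<rho> ** dagger (U \<otimes>\<^sub>o V)) = D \<rho>)"

end

theory Submission
  imports Defs
begin

text \<open>
  For a unit vector \<open>\<Psi>\<close> the local randomness is the Shannon entropy of \<open>p j = \<parallel>\<langle>j|\<Psi>\<parallel>\<^sup>2\<close>.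
  An incoherent Kraus operator \<open>A n\<close> maps each \<open>|j\<rangle>\<close> to a multiple of some \<open>|f n j\<rangle>\<close>.  Hence, for
  every set \<open>T\<close> of basis labels, the total weight that the post-measurement vectors
  \<open>(A n \<otimes> B n) \<Psi>\<close> put on the labels \<open>f n ` T\<close> is at least \<open>p T\<close>.  By the Gibbs inequality the
  average outcome entropy of these vectors is at most their average cross entropy relative to
  \<open>t n k = max {p j | f n j = k}\<close>; as \<open>{k. c \<le> t n k} = f n ` {j. c \<le> p j}\<close> for \<open>c > 0\<close>, stochastic
  dominance bounds this by the entropy of \<open>p\<close>.  So local randomness decreases on average on pure
  states, and applying the operation to a pure-state decomposition gives (BD2).  Incoherent
  unitaries and their adjoints are both incoherent, so (BD3) follows from (BD2).
\<close>

subsection \<open>Stochastic dominance and the Gibbs inequality\<close>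

text \<open>On a finite set a monotone function climbs by a nonnegative jump at each point. Points
  are added in increasing order: a new maximum contributes its rise over the previous maximum, and
  its step function vanishes at all smaller points.\<close>

lemma monotone_step_representation:
  fixes G :: "real \<Rightarrow> real"
  assumes "finite S" "mono_on S G"
  shows "\<exists>g h. (\<forall>c\<in>S. 0 \<le> h c) \<and> (\<forall>x\<in>S. G x = g + (\<Sum>c\<in>S. h c * of_bool (c \<le> x)))"
  using assms
proof (induction S rule: finite_linorder_max_induct)
  case empty
  then show ?case by simp
next
  case (insert b A)
  show ?case
  proof (cases "A = {}")
    case True
    \<comment> \<open>The least point stores its value in the constant \<open>g\<close> and has jump
      0, because \<open>G\<close> may be negative there while jumps may not.\<close>
    then show ?thesis by (intro exI[of _ "G b"] exI[of _ "\<lambda>_. 0"]) simp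
  next
    case False
    from insert obtain g h where h: "\<forall>c\<in>A. 0 \<le> h c"
      and G: "\<forall>x\<in>A. G x = g + (\<Sum>c\<in>A. h c * of_bool (c \<le> x))"
      by (auto simp: mono_on_def)
    have b: "b \<notin> A" using insert by auto
    have M: "Max A \<in> A" using False insert by simp
    define h' where "h' = h(b := G b - G (Max A))"
    have sumA: "(\<Sum>c\<in>A. h' c * of_bool (c \<le> x)) = (\<Sum>c\<in>A. h c * of_bool (c \<le> x))" for x
      using b by (intro sum.cong) (auto simp: h'_def)
    have Mb: "(\<Sum>c\<in>A. h c * of_bool (c \<le> b)) = (\<Sum>c\<in>A. h c * of_bool (c \<le> Max A))"
      using insert by (intro sum.cong) (auto simp: less_imp_le)
    have "G (Max A) \<le> G b"
      using insert.prems M insert.hyps by (auto simp: mono_on_def less_imp_le)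
    then have "\<forall>c\<in>insert b A. 0 \<le> h' c" using h by (auto simp: h'_def)
    moreover have "G x = g + (\<Sum>c\<in>insert b A. h' c * of_bool (c \<le> x))" if "x \<in> insert b A" for x
    proof (cases "x = b")
      case True
      have "G (Max A) = g + (\<Sum>c\<in>A. h c * of_bool (c \<le> Max A))" using G M by blast
      then show ?thesis using True b insert.hyps
        by (simp add: sumA Mb del: sum_mult_of_bool_eq sum_of_bool_mult_eq) (simp add: h'_def)
    next
      case False
      then have "x \<in> A" "\<not> b \<le> x" using that insert.hyps by auto
      then show ?thesis using G b insert.hyps
        by (simp add: sumA del: sum_mult_of_bool_eq sum_of_bool_mult_eq)
    qed
    ultimately show ?thesis by blast
  qed
qed

text \<open>By the step representation both sides are a constant times the total mass plus a
  nonnegative combination of tail masses. The constants agree by \<open>total\<close>, and the tails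
  are compared one threshold at a time by \<open>dom\<close>.\<close>

lemma stochastic_dominance_sum_mono:
  fixes G :: "real \<Rightarrow> real"
  assumes fin: "finite I" "finite K"
    and G: "mono_on (x ` I \<union> y ` K) G"
    and total: "sum u I = sum v K"
    and dom: "\<And>c. c \<in> x ` I \<union> y ` K \<Longrightarrow>
      (\<Sum>i\<in>I. u i * of_bool (c \<le> x i)) \<le> (\<Sum>k\<in>K. v k * of_bool (c \<le> y k))"
  shows "(\<Sum>i\<in>I. u i * G (x i)) \<le> (\<Sum>k\<in>K. v k * G (y k))"
proof -
  let ?S = "x ` I \<union> y ` K"
  obtain g h where h: "\<forall>c\<in>?S. 0 \<le> h c"
    and G: "\<forall>x\<in>?S. G x = g + (\<Sum>c\<in>?S. h c * of_bool (c \<le> x))"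
    using monotone_step_representation[of ?S G] fin G by auto
  \<comment> \<open>Layer-cake formula, stated for an arbitrary index type so that it applies to
    both \<open>I\<close> and \<open>K\<close>.\<close>
  have layer: "(\<Sum>i\<in>L. w i * G (z i)) = g * sum w L + (\<Sum>c\<in>?S. h c * (\<Sum>i\<in>L. w i * of_bool (c \<le> z i)))"
    if "z ` L \<subseteq> ?S" for L :: "'z set" and w z
  proof -
    have "(\<Sum>i\<in>L. w i * G (z i)) = (\<Sum>i\<in>L. g * w i + (\<Sum>c\<in>?S. h c * (w i * of_bool (c \<le> z i))))"
    proof (rule sum.cong[OF refl])
      fix i assume "i \<in> L"
      then have "G (z i) = g + (\<Sum>c\<in>?S. h c * of_bool (c \<le> z i))" using G that by blast
      then show "w i * G (z i) = g * w i + (\<Sum>c\<in>?S. h c * (w i * of_bool (c \<le> z i)))"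
        by (simp add: distrib_left sum_distrib_left mult_ac)
    qed
    also have "\<dots> = g * sum w L + (\<Sum>i\<in>L. \<Sum>c\<in>?S. h c * (w i * of_bool (c \<le> z i)))"
      by (simp add: sum.distrib sum_distrib_left)
    also have "(\<Sum>i\<in>L. \<Sum>c\<in>?S. h c * (w i * of_bool (c \<le> z i))) =
        (\<Sum>c\<in>?S. h c * (\<Sum>i\<in>L. w i * of_bool (c \<le> z i)))"
      by (subst sum.swap) (simp add: sum_distrib_left)
    finally show ?thesis .
  qed
  have "(\<Sum>c\<in>?S. h c * (\<Sum>i\<in>I. u i * of_bool (c \<le> x i))) \<le>
      (\<Sum>c\<in>?S. h c * (\<Sum>k\<in>K. v k * of_bool (c \<le> y k)))"
    using h dom by (intro sum_mono mult_left_mono) auto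
  then show ?thesis using layer[of x I u] layer[of y K v] total by simp
qed

text \<open>This is \<open>ln x \<le> x - 1\<close> at \<open>x = t * q / r\<close>. The correction
  \<open>(t * q - r) / ln 2\<close> is kept because it becomes nonpositive after summation as soon
  as the \<open>t\<close> sum to at most 1 and the \<open>r\<close> sum to \<open>q\<close>.\<close>

lemma gibbs_inequality_term:
  fixes q r t :: real
  assumes "0 \<le> r" "0 \<le> t" "r \<le> q" "0 < r \<Longrightarrow> 0 < t"
  shows "- (r * log 2 (r / q)) \<le> - (r * log 2 t) + (t * q - r) / ln 2"
proof (cases "r = 0")
  case True
  then show ?thesis using assms by simp
next
  case False
  then have pos: "0 < r" "0 < t" "0 < q" using assms by auto
  have "ln (t * q / r) \<le> t * q / r - 1"
    using pos by (intro ln_le_minus_one) simp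
  then have "r * ln (t * q / r) \<le> r * (t * q / r - 1)"
    using pos by (intro mult_left_mono) auto
  also have "\<dots> = t * q - r" using pos by (simp add: field_simps)
  finally have "r * (ln t + ln q - ln r) \<le> t * q - r"
    using pos by (simp add: ln_mult ln_div)
  then have "r * (ln t + ln q - ln r) / ln 2 \<le> (t * q - r) / ln 2"
    by (intro divide_right_mono) auto
  moreover have "r * (ln t + ln q - ln r) / ln 2 = r * log 2 t - r * log 2 (r / q)"
    using pos by (simp add: log_def ln_div diff_divide_distrib add_divide_distrib algebra_simps)
  ultimately show ?thesis by linarith
qed

subsection \<open>Operators\<close>

lemma inner_complex_vec: "inner v w = Re (braket v w)"
  by (simp add: inner_vec_def braket_def inner_complex_def)

lemma braket_self: "braket v v = complex_of_real ((norm v)\<^sup>2)"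
proof -
  have "Im (braket v v) = 0" by (simp add: braket_def mult.commute)
  moreover have "Re (braket v v) = (norm v)\<^sup>2"
    using inner_complex_vec[of v v] by (simp add: power2_norm_eq_inner)
  ultimately show ?thesis by (simp add: complex_eq_iff)
qed

lemma braket_commute: "braket w v = cnj (braket v w)"
  by (simp add: braket_def mult.commute)

lemma braket_dagger: "braket (dagger M *v v) w = braket v (M *v w)"
proof -
  have "braket (dagger M *v v) w = (\<Sum>i\<in>UNIV. \<Sum>k\<in>UNIV. M $ k $ i * cnj (v $ k) * w $ i)"
    by (simp add: braket_def dagger_def matrix_vector_mult_def sum_distrib_right)
  also have "\<dots> = (\<Sum>k\<in>UNIV. \<Sum>i\<in>UNIV. M $ k $ i * cnj (v $ k) * w $ i)"
    by (rule sum.swap)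
  also have "\<dots> = braket v (M *v w)"
    by (simp add: braket_def matrix_vector_mult_def sum_distrib_left mult_ac)
  finally show ?thesis .
qed

lemma dagger_dagger [simp]: "dagger (dagger M) = M"
  by (simp add: dagger_def vec_eq_iff)

lemma dagger_mult: "dagger (M ** N) = dagger N ** dagger M"
  by (simp add: dagger_def matrix_matrix_mult_def vec_eq_iff mult.commute)

lemma braket_mult_dagger: "braket v ((M ** N ** dagger M) *v w) = braket (dagger M *v v) (N *v (dagger M *v w))"
  by (simp add: braket_dagger matrix_vector_mul_assoc matrix_mul_assoc)

lemma ketbra_mult_vec: "ketbra v w *v x = braket w x *s v"
  by (simp add: ketbra_def braket_def matrix_vector_mult_def vec_eq_iff sum_distrib_right
      sum_distrib_left mult_ac)

lemma ketbra_conj: "M ** ketbra v w ** dagger M = ketbra (M *v v) (M *v w)"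
proof -
  have *: "(\<Sum>k\<in>UNIV. (\<Sum>l\<in>UNIV. M $ i $ l * (v $ l * cnj (w $ k))) * cnj (M $ j $ k)) =
    (\<Sum>l\<in>UNIV. M $ i $ l * v $ l) * (\<Sum>k\<in>UNIV. cnj (M $ j $ k) * cnj (w $ k))" for i j
    unfolding sum_product sum_distrib_right by (subst sum.swap) (simp add: sum_distrib_left mult_ac)
  then show ?thesis
    by (simp add: ketbra_def dagger_def matrix_matrix_mult_def matrix_vector_mult_def vec_eq_iff *)
qed

lemma ketbra_scaleR: "ketbra (c *\<^sub>R v) (c *\<^sub>R v) = c\<^sup>2 *\<^sub>R ketbra v v"
  by (simp add: ketbra_def vec_eq_iff power2_eq_square)

lemma trace_ketbra: "trace (ketbra v v) = complex_of_real ((norm v)\<^sup>2)"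
  unfolding braket_self[symmetric] by (simp add: trace_def ketbra_def braket_def mult.commute)

lemma matrix_vector_mult_sum: "(\<Sum>i\<in>I. M i) *v x = (\<Sum>i\<in>I. M i *v (x :: complex ^ 'n))"
  by (induction I rule: infinite_finite_induct) (auto simp: matrix_vector_mult_add_rdistrib)

lemma matrix_mult_sum_left: "(A :: 'n::finite op) ** (\<Sum>i\<in>I. M i) = (\<Sum>i\<in>I. A ** M i)"
  by (induction I rule: infinite_finite_induct) (auto simp: matrix_add_ldistrib)

lemma matrix_mult_sum_right: "(\<Sum>i\<in>I. M i) ** (A :: 'n::finite op) = (\<Sum>i\<in>I. M i ** A)"
  by (induction I rule: infinite_finite_induct)
    (auto simp: matrix_matrix_mult_def vec_eq_iff distrib_right sum.distrib)

lemma matrix_vector_mult_linear_sum: "(A :: 'n::finite op) *v (\<Sum>i\<in>I. v i) = (\<Sum>i\<in>I. A *v v i)"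
  by (induction I rule: infinite_finite_induct) (auto simp: matrix_vector_right_distrib)

lemma braket_sum_right: "braket v (\<Sum>i\<in>I. w i) = (\<Sum>i\<in>I. braket v (w i))"
  by (induction I rule: infinite_finite_induct) (auto simp: braket_def sum.distrib distrib_left)

lemma braket_smult_right: "braket v (c *s w) = c * braket v w"
  by (simp add: braket_def sum_distrib_left mult_ac)

lemma braket_diff_right: "braket v (w - x) = braket v w - braket v x"
  by (simp add: braket_def sum_subtractf right_diff_distrib)

lemma braket_scaleR_right: "braket v (c *\<^sub>R w) = c *\<^sub>R braket v w"
  by (simp add: braket_def scaleR_sum_right)

lemma dagger_tensor: "dagger (A \<otimes>\<^sub>o B) = dagger A \<otimes>\<^sub>o dagger B"
  by (simp add: dagger_def tensor_op_def vec_eq_iff)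

lemma tensor_mult: "(A \<otimes>\<^sub>o B) ** (C \<otimes>\<^sub>o D) = (A ** C) \<otimes>\<^sub>o (B ** D)"
  by (simp add: tensor_op_def matrix_matrix_mult_def vec_eq_iff sum_product sum.cartesian_product
      UNIV_Times_UNIV[symmetric] case_prod_unfold mult_ac del: UNIV_Times_UNIV)

lemma tensor_mat_1: "mat 1 \<otimes>\<^sub>o mat 1 = mat 1"
  by (auto simp: tensor_op_def mat_def vec_eq_iff)

section \<open>Positive semidefinite matrices as sums of rank-one terms\<close>

text \<open>The two cross terms are conjugate because \<open>M\<close> is Hermitian, so their real
  parts add up. Choosing \<open>c\<close> well turns positivity of the form into bounds on matrix
  entries.\<close>

lemma quadratic_form_expand:
  assumes "dagger M = M"
  shows "Re (braket (y + c *s x) (M *v (y + c *s x))) =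
    Re (braket y (M *v y)) + 2 * Re (c * braket y (M *v x)) + (cmod c)\<^sup>2 * Re (braket x (M *v x))"
proof -
  have xy: "braket x (M *v y) = cnj (braket y (M *v x))"
    using assms by (metis braket_commute braket_dagger)
  have "braket (y + c *s x) (M *v (y + c *s x)) =
      braket y (M *v y) + c * braket y (M *v x) + cnj c * braket x (M *v y)
      + cnj c * c * braket x (M *v x)"
    by (simp add: matrix_vector_right_distrib vector_scalar_commute braket_def
        distrib_left distrib_right sum.distrib sum_distrib_left mult_ac)
  moreover have "cnj c * c = complex_of_real ((cmod c)\<^sup>2)"
    by (metis complex_norm_square mult.commute)
  ultimately show ?thesis by (simp add: xy)
qed

text \<open>Cholesky elimination, by induction on a set \<open>S\<close> outside which all rows
  vanish. If the pivot \<open>M $ i $ i\<close> is 0, positivity forces row \<open>i\<close> to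
  vanish already; otherwise subtracting one rank-one term clears that row and preserves
  positivity.\<close>

lemma psd_decomposition_support:
  fixes M :: "'n::finite op"
  assumes "finite S" "dagger M = M" "\<And>v. 0 \<le> Re (braket v (M *v v))"
    and "\<And>i j. i \<notin> S \<Longrightarrow> M $ i $ j = 0"
  shows "\<exists>v. M = (\<Sum>i\<in>S. ketbra (v i) (v i))"
  using assms
proof (induction S arbitrary: M rule: finite_induct)
  case empty
  then show ?case by (simp add: vec_eq_iff)
next
  case (insert i S)
  let ?x = "axis i 1 :: complex ^ 'n"
  have herm: "M $ j $ k = cnj (M $ k $ j)" for j k
    using arg_cong[OF insert.prems(1), of "\<lambda>X. X $ j $ k"] by (simp add: dagger_def)
  have Mx: "(M *v ?x) $ j = M $ j $ i" for j
    by (simp add: matrix_vector_mult_def axis_def if_distrib cong: if_cong)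
  have bx: "braket (axis j 1) v = v $ j" for j and v :: "complex ^ 'n"
    by (simp add: braket_def axis_def if_distrib if_distribR cong: if_cong)
  define m where "m = Re (M $ i $ i)"
  have Mii: "M $ i $ i = complex_of_real m"
    using herm[of i i] by (simp add: m_def complex_eq_iff)
  have m0: "0 \<le> m" using insert.prems(2)[of ?x] by (simp add: bx Mx m_def)
  show ?case
  proof (cases "m = 0")
    case True
    have "M $ j $ i = 0" for j
    proof (rule ccontr)
      assume nz: "M $ j $ i \<noteq> 0"
      let ?y = "axis j 1 :: complex ^ 'n"
      define d where "d = (cmod (M $ j $ i))\<^sup>2"
      have "0 < d" using nz by (simp add: d_def)
      define Q where "Q = Re (braket ?y (M *v ?y))"
      \<comment> \<open>The pivot is 0, so the form at the test vector is only affine in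
        \<open>t\<close>. This choice gives it the value \<open>- Q - 2 * d\<close>, which is
        negative.\<close>
      define t where "t = Q / d + 1"
      have "cnj (M $ j $ i) * M $ j $ i = complex_of_real d"
        unfolding d_def by (metis complex_norm_square mult.commute)
      then have "0 \<le> Q - 2 * t * d"
        using quadratic_form_expand[OF insert.prems(1), of ?y "- complex_of_real t * cnj (M $ j $ i)" ?x]
          insert.prems(2)[of "?y + (- complex_of_real t * cnj (M $ j $ i)) *s ?x"] True
        by (simp add: bx Mx Mii Q_def mult.assoc)
      moreover have "t * d = Q + d" using \<open>0 < d\<close> by (simp add: t_def field_simps)
      moreover have "0 \<le> Q" unfolding Q_def by (rule insert.prems(2))
      ultimately show False using \<open>0 < d\<close> by linarith
    qed
    then have "M $ k $ j = 0" if "k \<notin> S" for k j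
      using that insert.prems(3)[of k j] herm[of i j] by (cases "k = i") auto
    then obtain v where v: "M = (\<Sum>i\<in>S. ketbra (v i) (v i))"
      using insert.IH[of M] insert.prems by blast
    have "M = (\<Sum>k\<in>insert i S. ketbra ((v(i := 0)) k) ((v(i := 0)) k))"
    proof -
      have "(\<Sum>k\<in>S. ketbra ((v(i := 0)) k) ((v(i := 0)) k)) = (\<Sum>k\<in>S. ketbra (v k) (v k))"
        using insert.hyps by (intro sum.cong) auto
      moreover have "ketbra 0 0 = (0 :: 'n op)" by (simp add: ketbra_def vec_eq_iff)
      ultimately show ?thesis using v insert.hyps by simp
    qed
    then show ?thesis by blast
  next
    case False
    then have m: "0 < m" using m0 by simp
    \<comment> \<open>A Cholesky step: subtracting \<open>ketbra w w\<close> clears row \<open>i\<close>.\<close>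
    define w where "w = (1 / sqrt m) *\<^sub>R (M *v ?x)"
    define M' where "M' = M - ketbra w w"
    have ww: "ketbra w w $ j $ k = M $ j $ i * cnj (M $ k $ i) / complex_of_real m" for j k
    proof -
      have "complex_of_real (sqrt m) * complex_of_real (sqrt m) = complex_of_real m"
        using m by (metis of_real_mult real_sqrt_mult_self abs_of_pos)
      then show ?thesis using m
        by (simp add: ketbra_def w_def Mx) (simp add: scaleR_conv_of_real divide_simps)
    qed
    have "dagger M' = M'"
    proof -
      have "cnj (M' $ k $ j) = M' $ j $ k" for j k
        using herm[of k j] by (simp add: M'_def ww mult.commute)
      then show ?thesis by (simp add: dagger_def vec_eq_iff)
    qed
    moreover have "0 \<le> Re (braket y (M' *v y))" for y
    proof -
      let ?b = "braket y (M *v ?x)"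
      \<comment> \<open>The minimiser over \<open>c\<close> of the quadratic form of
        \<open>M\<close> at \<open>y + c *s ?x\<close>; the minimum is exactly the form of
        \<open>M'\<close> at \<open>y\<close>.\<close>
      define c where "c = - cnj ?b / complex_of_real m"
      have cb: "c * ?b = - complex_of_real ((cmod ?b)\<^sup>2 / m)"
        unfolding c_def of_real_divide complex_norm_square by (simp add: mult.commute)
      have "Re (braket ?x (M *v ?x)) = m" by (simp add: bx Mx Mii)
      moreover have "(cmod c)\<^sup>2 * m = (cmod ?b)\<^sup>2 / m"
        using m by (simp add: c_def norm_divide power_divide power2_eq_square)
      ultimately have "0 \<le> Re (braket y (M *v y)) - (cmod ?b)\<^sup>2 / m"
        using quadratic_form_expand[OF insert.prems(1), of y c ?x]
          insert.prems(2)[of "y + c *s ?x"] cb by simp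
      moreover have "Re (braket y (ketbra w w *v y)) = (cmod ?b)\<^sup>2 / m"
      proof -
        have "braket y (ketbra w w *v y) = cnj (braket y w) * braket y w"
          by (simp add: ketbra_mult_vec braket_smult_right) (metis braket_commute)
        also have "\<dots> = complex_of_real ((cmod (braket y w))\<^sup>2)"
          by (metis complex_norm_square mult.commute)
        also have "(cmod (braket y w))\<^sup>2 = (cmod ?b)\<^sup>2 / m"
          using m by (simp add: w_def braket_scaleR_right power_divide power_mult_distrib)
        finally show ?thesis by simp
      qed
      moreover have "braket y (M' *v y) = braket y (M *v y) - braket y (ketbra w w *v y)"
        by (simp add: M'_def matrix_vector_mult_diff_rdistrib braket_diff_right)
      ultimately show ?thesis by simp
    qed
    moreover have "M' $ k $ j = 0" if "k \<notin> S" for k j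
    proof (cases "k = i")
      case True
      then show ?thesis using m herm[of i j] by (simp add: M'_def ww Mii)
    next
      case False
      then show ?thesis using that insert.prems(3) by (simp add: M'_def ww)
    qed
    ultimately obtain v where v: "M' = (\<Sum>i\<in>S. ketbra (v i) (v i))"
      using insert.IH[of M'] by blast
    have "(\<Sum>k\<in>S. ketbra ((v(i := w)) k) ((v(i := w)) k)) = (\<Sum>k\<in>S. ketbra (v k) (v k))"
      using insert.hyps by (intro sum.cong) auto
    then have "M = (\<Sum>k\<in>insert i S. ketbra ((v(i := w)) k) ((v(i := w)) k))"
      using v insert.hyps by (simp add: M'_def algebra_simps)
    then show ?thesis by blast
  qed
qed

lemma psd_decomposition:
  fixes M :: "'n::finite op"
  assumes "dagger M = M" "\<And>v. 0 \<le> Re (braket v (M *v v))"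
  obtains v :: "'n \<Rightarrow> complex ^ 'n" where "M = (\<Sum>i\<in>UNIV. ketbra (v i) (v i))"
  using psd_decomposition_support[of UNIV M] assms by auto

subsection \<open>Local randomness as a Shannon entropy\<close>

text \<open>The partial inner product of \<open>J j\<close> with \<open>\<Psi>\<close>: the
  unnormalised state of \<open>B\<close> left when \<open>A\<close> is found in
  \<open>J j\<close>.\<close>

definition component :: "('a \<Rightarrow> complex ^ 'a) \<Rightarrow> 'a \<Rightarrow> complex ^ ('a::finite \<times> 'b::finite) \<Rightarrow> complex ^ 'b"
  where "component J j \<Psi> = (\<chi> b. \<Sum>a\<in>UNIV. cnj (J j $ a) * \<Psi> $ (a, b))"

definition outcome_weight :: "('a \<Rightarrow> complex ^ 'a) \<Rightarrow> complex ^ ('a::finite \<times> 'b::finite) \<Rightarrow> 'a \<Rightarrow> real"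
  where "outcome_weight J \<Psi> j = (norm (component J j \<Psi>))\<^sup>2"

text \<open>
  The degree-one homogeneous extension of local randomness, which absorbs the weights of a
  decomposition into its vectors.
\<close>

definition outcome_entropy :: "('a \<Rightarrow> complex ^ 'a) \<Rightarrow> complex ^ ('a::finite \<times> 'b::finite) \<Rightarrow> real"
  where "outcome_entropy J \<Psi> =
    - (\<Sum>j\<in>UNIV. outcome_weight J \<Psi> j * log 2 (outcome_weight J \<Psi> j / (norm \<Psi>)\<^sup>2))"

lemma sum_UNIV_pair:
  "(\<Sum>x\<in>UNIV. h (x :: 'a::finite \<times> 'b::finite)) = (\<Sum>a\<in>UNIV. \<Sum>b\<in>UNIV. h (a, b))"
  by (simp add: sum.cartesian_product UNIV_Times_UNIV[symmetric] del: UNIV_Times_UNIV)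

text \<open>Orthonormality says that the square matrix of bras is a left inverse of the matrix of
  kets. It is then also a right inverse, which is the completeness relation.\<close>

lemma orthonormal_basis_complete:
  assumes "orthonormal_basis J"
  shows "(\<Sum>j\<in>UNIV. J j $ a * cnj (J j $ b)) = (if a = b then 1 else 0)"
proof -
  define U :: "'a op" where "U = (\<chi> j a. cnj (J j $ a))"
  define W :: "'a op" where "W = (\<chi> a j. J j $ a)"
  have "U ** W = mat 1"
    using assms by (simp add: orthonormal_basis_def braket_def U_def W_def matrix_matrix_mult_def
        mat_def vec_eq_iff)
  then have "W ** U = mat 1" by (simp add: matrix_left_right_inverse)
  then have "(W ** U) $ a $ b = mat 1 $ a $ b" by simp
  then show ?thesis by (simp add: U_def W_def matrix_matrix_mult_def mat_def)
qed

lemma orthonormal_basis_expansion: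
  assumes "orthonormal_basis J"
  shows "(\<Sum>j\<in>UNIV. braket (J j) v *s J j) = v"
proof -
  have "(\<Sum>j\<in>UNIV. (\<Sum>a\<in>UNIV. cnj (J j $ a) * v $ a) * J j $ b) = v $ b" for b
  proof -
    have "(\<Sum>j\<in>UNIV. (\<Sum>a\<in>UNIV. cnj (J j $ a) * v $ a) * J j $ b)
        = (\<Sum>a\<in>UNIV. v $ a * (\<Sum>j\<in>UNIV. J j $ b * cnj (J j $ a)))"
      unfolding sum_distrib_left sum_distrib_right by (subst sum.swap) (simp add: mult_ac)
    then show ?thesis
      by (simp add: orthonormal_basis_complete[OF assms] if_distrib cong: if_cong)
  qed
  then show ?thesis by (simp add: vec_eq_iff braket_def)
qed

lemma braket_orthonormal_expansion:
  assumes "orthonormal_basis J"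
  shows "braket v w = (\<Sum>j\<in>UNIV. braket v (J j) * braket (J j) w)"
  by (subst (1) orthonormal_basis_expansion[OF assms, of w, symmetric])
    (simp add: braket_sum_right braket_smult_right mult.commute)

lemma component_expansion:
  assumes "orthonormal_basis J"
  shows "\<Psi> $ (a, b) = (\<Sum>j\<in>UNIV. J j $ a * component J j \<Psi> $ b)"
proof -
  have "(\<Sum>j\<in>UNIV. J j $ a * component J j \<Psi> $ b)
      = (\<Sum>c\<in>UNIV. \<Psi> $ (c, b) * (\<Sum>j\<in>UNIV. J j $ a * cnj (J j $ c)))"
    unfolding component_def sum_distrib_left vec_lambda_beta
    by (subst sum.swap) (simp add: mult_ac)
  then show ?thesis
    by (simp add: orthonormal_basis_complete[OF assms] if_distrib cong: if_cong)
qed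

text \<open>Parseval's identity over the blocks of \<open>A\<close>. Only \<open>\<Phi>\<close> is
  expanded in the basis; the remaining sum over \<open>a\<close> rebuilds the components of
  \<open>\<Psi>\<close>.\<close>

lemma inner_component:
  assumes "orthonormal_basis J"
  shows "inner \<Psi> \<Phi> = (\<Sum>j\<in>UNIV. inner (component J j \<Psi>) (component J j \<Phi>))"
proof -
  have "braket \<Psi> \<Phi> = (\<Sum>a\<in>UNIV. \<Sum>b\<in>UNIV. cnj (\<Psi> $ (a, b)) * (\<Sum>j\<in>UNIV. J j $ a * component J j \<Phi> $ b))"
    by (simp add: braket_def sum_UNIV_pair component_expansion[OF assms, symmetric])
  also have "\<dots> = (\<Sum>a\<in>UNIV. \<Sum>b\<in>UNIV. \<Sum>j\<in>UNIV. cnj (\<Psi> $ (a, b)) * J j $ a * component J j \<Phi> $ b)"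
    by (simp add: sum_distrib_left mult_ac)
  also have "\<dots> = (\<Sum>b\<in>UNIV. \<Sum>j\<in>UNIV. \<Sum>a\<in>UNIV. cnj (\<Psi> $ (a, b)) * J j $ a * component J j \<Phi> $ b)"
    by (subst sum.swap) (intro sum.cong refl sum.swap)
  also have "\<dots> = (\<Sum>j\<in>UNIV. \<Sum>b\<in>UNIV. \<Sum>a\<in>UNIV. cnj (\<Psi> $ (a, b)) * J j $ a * component J j \<Phi> $ b)"
    by (rule sum.swap)
  also have "\<dots> = (\<Sum>j\<in>UNIV. braket (component J j \<Psi>) (component J j \<Phi>))"
    by (simp add: braket_def component_def[of J _ \<Psi>] sum_distrib_right
        sum_distrib_left mult_ac)
  finally show ?thesis by (simp add: inner_complex_vec)
qed

lemma sum_outcome_weight: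
  assumes "orthonormal_basis J"
  shows "(\<Sum>j\<in>UNIV. outcome_weight J \<Psi> j) = (norm \<Psi>)\<^sup>2"
  using inner_component[OF assms, of \<Psi> \<Psi>] by (simp add: outcome_weight_def power2_norm_eq_inner)

lemma outcome_weight_nonneg [simp]: "0 \<le> outcome_weight J \<Psi> j"
  by (simp add: outcome_weight_def)

lemma component_scaleR: "component J j (c *\<^sub>R \<Psi>) = c *\<^sub>R component J j \<Psi>"
  by (simp add: component_def vec_eq_iff scaleR_sum_right)

text \<open>The ratio inside the logarithm is scale invariant, so only the outer weight scales. For
  \<open>c = 0\<close> the ratio degenerates, but all weights vanish.\<close>

lemma outcome_entropy_scaleR: "outcome_entropy J (c *\<^sub>R \<Psi>) = c\<^sup>2 * outcome_entropy J \<Psi>"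
proof (cases "c = 0")
  case True
  then show ?thesis by (simp add: outcome_entropy_def outcome_weight_def component_def zero_vec_def)
next
  case False
  then show ?thesis
    by (simp add: outcome_entropy_def outcome_weight_def component_scaleR power_mult_distrib
        sum_distrib_left mult.assoc)
qed

lemma outcome_entropy_nonneg:
  assumes "orthonormal_basis J"
  shows "0 \<le> outcome_entropy J \<Psi>"
proof -
  have "outcome_weight J \<Psi> j * log 2 (outcome_weight J \<Psi> j / (norm \<Psi>)\<^sup>2) \<le> 0" for j
  proof (cases "outcome_weight J \<Psi> j = 0")
    case False
    then have pos: "0 < outcome_weight J \<Psi> j" by (simp add: order_less_le)
    have le: "outcome_weight J \<Psi> j \<le> (norm \<Psi>)\<^sup>2"
      unfolding sum_outcome_weight[OF assms, symmetric] by (intro member_le_sum) auto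
    have "log 2 (outcome_weight J \<Psi> j / (norm \<Psi>)\<^sup>2) \<le> 0"
      using pos le order_less_le_trans[OF pos le]
      by (subst log_le_zero_cancel_iff) (auto simp: divide_le_eq)
    then show ?thesis by (simp add: mult_nonneg_nonpos)
  qed simp
  then show ?thesis by (simp add: outcome_entropy_def sum_nonpos)
qed

text \<open>With the index of \<open>B\<close> summed last, the diagonal entry becomes a sum of
  squared moduli of the entries of the component.\<close>

lemma braket_partial_trace_ketbra:
  "braket (J j) (partial_trace_B (ketbra \<Psi> \<Psi>) *v J j) = complex_of_real (outcome_weight J \<Psi> j)"
proof -
  have "braket (J j) (partial_trace_B (ketbra \<Psi> \<Psi>) *v J j) =
     (\<Sum>a\<in>UNIV. \<Sum>c\<in>UNIV. \<Sum>b\<in>UNIV. (cnj (J j $ a) * \<Psi> $ (a, b)) * (J j $ c * cnj (\<Psi> $ (c, b))))"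
    by (simp add: braket_def partial_trace_B_def ketbra_def matrix_vector_mult_def
        sum_distrib_left sum_distrib_right mult_ac)
  also have "\<dots> = (\<Sum>b\<in>UNIV. \<Sum>a\<in>UNIV. \<Sum>c\<in>UNIV. (cnj (J j $ a) * \<Psi> $ (a, b)) * (J j $ c * cnj (\<Psi> $ (c, b))))"
    by (subst sum.swap[of _ _ UNIV]) (subst sum.swap, intro sum.cong refl sum.swap)
  also have "\<dots> = (\<Sum>b\<in>UNIV. component J j \<Psi> $ b * cnj (component J j \<Psi> $ b))"
    by (simp add: component_def sum_product)
  also have "\<dots> = complex_of_real (outcome_weight J \<Psi> j)"
    unfolding outcome_weight_def braket_self[symmetric] by (simp add: braket_def mult.commute)
  finally show ?thesis .
qed

lemma dephase_mult_vec:
  "dephase J M *v v = (\<Sum>j\<in>UNIV. (braket (J j) (M *v J j) * braket (J j) v) *s J j)"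
proof -
  have "mat c *v w = c *s w" for c :: complex and w :: "complex ^ 'a"
    by (simp add: mat_def matrix_vector_mult_def vec_eq_iff if_distrib if_distribR cong: if_cong)
  then show ?thesis
    by (simp add: dephase_def matrix_vector_mult_sum matrix_vector_mul_assoc[symmetric]
        ketbra_mult_vec)
qed

text \<open>The dephased matrix acts on \<open>J j\<close> as the scalar \<open>c j\<close>, so the
  eigenspace of \<open>x\<close> is spanned by the \<open>J j\<close> with \<open>c j = x\<close>.
  Its dimension counts these labels, and grouping labels by the value of \<open>c\<close> turns the
  sum over distinct eigenvalues into a sum over labels.\<close>

lemma von_neumann_entropy_dephase:
  assumes J: "orthonormal_basis J"
    and c: "\<And>j. braket (J j) (M *v J j) = complex_of_real (c j)"
  shows "von_neumann_entropy (dephase J M) = - (\<Sum>j\<in>UNIV. c j * log 2 (c j))"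
proof -
  have JJ: "braket (J i) (J j) = (if i = j then 1 else 0)" for i j
    using J by (simp add: orthonormal_basis_def)
  have coord: "braket (J i) (dephase J M *v v) = complex_of_real (c i) * braket (J i) v" for i v
    by (simp add: dephase_mult_vec c braket_sum_right braket_smult_right JJ if_distrib cong: if_cong)
  have ext: "v = w" if "\<And>i. braket (J i) v = braket (J i) w" for v w
    by (metis (no_types, lifting) that orthonormal_basis_expansion[OF J] sum.cong)
  have eig: "v \<in> eigenspace (dephase J M) x \<longleftrightarrow> (\<forall>i. c i \<noteq> x \<longrightarrow> braket (J i) v = 0)" for v x
  proof -
    have "v \<in> eigenspace (dephase J M) x \<longleftrightarrow>
        (\<forall>i. braket (J i) (dephase J M *v v) = braket (J i) (complex_of_real x *s v))"
      unfolding eigenspace_def mem_Collect_eq using ext by metis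
    then show ?thesis by (auto simp: coord braket_smult_right)
  qed
  have eigJ: "J j \<in> eigenspace (dephase J M) x" if "c j = x" for j x
    using that by (auto simp: eig JJ)
  have inj: "inj J"
    by (rule injI) (metis JJ zero_neq_one)
  have dim: "vec.dim (eigenspace (dephase J M) x) = card {j. c j = x}" for x
  proof -
    let ?B = "J ` {j. c j = x}"
    have "vec.independent ?B"
    proof (rule vec.independent_if_scalars_zero)
      show "finite ?B" by simp
    next
      fix h y assume z: "(\<Sum>y\<in>?B. h y *s y) = 0" and "y \<in> ?B"
      then obtain j where j: "y = J j" "c j = x" by auto
      have "braket (J j) (\<Sum>y\<in>?B. h y *s y) = (\<Sum>i | c i = x. h (J i) * braket (J j) (J i))"
        using inj by (simp add: sum.reindex inj_on_subset[OF inj] braket_sum_right braket_smult_right)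
      also have "\<dots> = h (J j)" using j by (simp add: JJ if_distrib cong: if_cong)
      finally show "h y = 0" using z j by (simp add: braket_def)
    qed
    moreover have "eigenspace (dephase J M) x \<subseteq> vec.span ?B"
    proof
      fix v assume v: "v \<in> eigenspace (dephase J M) x"
      have "(\<Sum>j\<in>UNIV. braket (J j) v *s J j) \<in> vec.span ?B"
      proof (rule vec.span_sum)
        fix j
        show "braket (J j) v *s J j \<in> vec.span ?B"
          using v eig by (cases "c j = x") (auto intro: vec.span_scale vec.span_base vec.span_zero)
      qed
      then show "v \<in> vec.span ?B" by (simp add: orthonormal_basis_expansion[OF J])
    qed
    moreover have "?B \<subseteq> eigenspace (dephase J M) x" using eigJ by auto
    ultimately have "vec.dim (eigenspace (dephase J M) x) = card ?B"
      using vec.dim_unique by blast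
    then show ?thesis by (simp add: card_image inj_on_subset[OF inj])
  qed
  have "eigenspace (dephase J M) x \<noteq> {0} \<longleftrightarrow> x \<in> range c" for x
  proof
    assume "x \<in> range c"
    then obtain j where "J j \<in> eigenspace (dephase J M) x" using eigJ by auto
    moreover have "J j \<noteq> 0" using JJ[of j j] by (auto simp: braket_def)
    ultimately show "eigenspace (dephase J M) x \<noteq> {0}" by blast
  next
    assume nz: "eigenspace (dephase J M) x \<noteq> {0}"
    have "0 \<in> eigenspace (dephase J M) x" by (simp add: eig braket_def)
    with nz obtain v where v: "v \<in> eigenspace (dephase J M) x" "v \<noteq> 0" by blast
    show "x \<in> range c"
    proof (rule ccontr)
      assume "x \<notin> range c"
      then have "c i \<noteq> x" for i by auto
      then have "braket (J i) v = 0" for i using v eig by blast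
      then have "braket (J i) v = braket (J i) 0" for i by (simp add: braket_def[of _ 0])
      then show False using ext v by blast
    qed
  qed
  then have "von_neumann_entropy (dephase J M) = - (\<Sum>x\<in>range c. real (card {j. c j = x}) * (x * log 2 x))"
    by (simp add: von_neumann_entropy_def dim)
  also have "(\<Sum>x\<in>range c. real (card {j. c j = x}) * (x * log 2 x)) =
      (\<Sum>x\<in>range c. \<Sum>j | j \<in> UNIV \<and> c j = x. c j * log 2 (c j))"
    by (intro sum.cong) auto
  also have "\<dots> = (\<Sum>j\<in>UNIV. c j * log 2 (c j))"
    by (rule sum.group) auto
  finally show ?thesis .
qed

lemma local_randomness_eq_outcome_entropy:
  assumes "orthonormal_basis J" "norm \<Psi> = 1"
  shows "local_randomness J \<Psi> = outcome_entropy J \<Psi>"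
  using von_neumann_entropy_dephase[where c = "outcome_weight J \<Psi>", OF assms(1) braket_partial_trace_ketbra]
    assms(2)
  by (simp add: local_randomness_def outcome_entropy_def)

subsection \<open>Incoherent operations on pure states\<close>

text \<open>Applied to the incoherent state \<open>ketbra (J j) (J j)\<close>, the operator yields a
  rank-one matrix whose off-diagonal entries are products of two coefficients of
  \<open>K *v J j\<close>. These products vanish, so at most one coefficient is nonzero.\<close>

lemma incoherent_kraus_map:
  assumes J: "orthonormal_basis J" and K: "incoherent_kraus J K"
  obtains f where "\<And>j k. braket (J k) (K *v J j) \<noteq> 0 \<Longrightarrow> k = f j"
proof -
  have JJ: "braket (J i) (J j) = (if i = j then 1 else 0)" for i j
    using J by (simp add: orthonormal_basis_def)
  have uniq: "k = l" if "braket (J k) (K *v J j) \<noteq> 0" "braket (J l) (K *v J j) \<noteq> 0" for j k l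
  proof (rule ccontr)
    assume "k \<noteq> l"
    have "dagger (ketbra (J j) (J j)) = ketbra (J j) (J j)"
      by (simp add: dagger_def ketbra_def vec_eq_iff mult.commute)
    moreover have "0 \<le> Re (braket v (ketbra (J j) (J j) *v v))" for v
    proof -
      have "braket v (ketbra (J j) (J j) *v v) = braket (J j) v * cnj (braket (J j) v)"
        by (simp add: ketbra_mult_vec braket_smult_right) (metis braket_commute)
      then show ?thesis by (simp add: complex_norm_square[symmetric])
    qed
    moreover have "trace (ketbra (J j) (J j)) = 1"
      using JJ[of j j] by (simp add: trace_ketbra braket_self)
    moreover have "diagonal_in J (ketbra (J j) (J j))"
      by (simp add: diagonal_in_def ketbra_mult_vec braket_smult_right JJ)
    ultimately have "diagonal_in J (K ** ketbra (J j) (J j) ** dagger K)"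
      using K by (simp add: incoherent_kraus_def incoherent_state_def density_op_def)
    then have "braket (K *v J j) (J l) * braket (J k) (K *v J j) = 0"
      using \<open>k \<noteq> l\<close> by (simp add: diagonal_in_def ketbra_conj ketbra_mult_vec braket_smult_right)
    then show False using that braket_commute[of "K *v J j" "J l"] by simp
  qed
  show thesis
  proof (rule that)
    fix j k assume k: "braket (J k) (K *v J j) \<noteq> 0"
    \<comment> \<open>Where \<open>K *v J j\<close> is 0 the chosen label is arbitrary, which is
      harmless since only nonzero coefficients are constrained.\<close>
    then show "k = (SOME k. braket (J k) (K *v J j) \<noteq> 0)"
      by (intro uniq[OF k] someI[where P = "\<lambda>k. braket (J k) (K *v J j) \<noteq> 0"])
  qed
qed

text \<open>Converse of the label map. After expansion in \<open>J\<close>, diagonality of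
  \<open>\<sigma>\<close> leaves only \<open>k = l\<close>, and a nonzero term would force
  \<open>i = f k = j\<close>.\<close>

lemma incoherent_krausI:
  assumes J: "orthonormal_basis J"
    and f: "\<And>j k. braket (J k) (K *v J j) \<noteq> 0 \<Longrightarrow> k = f j"
  shows "incoherent_kraus J K"
  unfolding incoherent_kraus_def diagonal_in_def
proof (intro allI impI)
  fix \<sigma> and i j :: 'a assume s: "incoherent_state J \<sigma>" and ij: "i \<noteq> j"
  have off: "braket (J k) (\<sigma> *v J l) = 0" if "k \<noteq> l" for k l
    using s that by (simp add: incoherent_state_def diagonal_in_def)
  have "braket (J i) ((K ** \<sigma> ** dagger K) *v J j) = braket (dagger K *v J i) (\<sigma> *v (dagger K *v J j))"
    by (rule braket_mult_dagger)
  also have "\<dots> = (\<Sum>k\<in>UNIV. braket (J i) (K *v J k) * braket (J k) (\<sigma> *v (dagger K *v J j)))"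
    by (subst braket_orthonormal_expansion[OF J]) (simp only: braket_dagger)
  also have "\<dots> = (\<Sum>k\<in>UNIV. braket (J i) (K *v J k) *
      (\<Sum>l\<in>UNIV. braket (J l) (dagger K *v J j) * braket (J k) (\<sigma> *v J l)))"
    by (subst orthonormal_basis_expansion[OF J, of "dagger K *v J j", symmetric])
      (simp add: matrix_vector_mult_linear_sum vector_scalar_commute braket_sum_right
        braket_smult_right)
  also have "\<dots> = (\<Sum>k\<in>UNIV. \<Sum>l\<in>UNIV.
      braket (J i) (K *v J k) * cnj (braket (J j) (K *v J l)) * braket (J k) (\<sigma> *v J l))"
  proof -
    have "braket (J l) (dagger K *v J j) = cnj (braket (J j) (K *v J l))" for l
      by (metis braket_commute braket_dagger)
    then show ?thesis by (simp add: sum_distrib_left mult.assoc)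
  qed
  also have "\<dots> = 0"
  proof (intro sum.neutral ballI)
    fix k l
    show "braket (J i) (K *v J k) * cnj (braket (J j) (K *v J l)) * braket (J k) (\<sigma> *v J l) = 0"
      using off[of k l] f[of i k] f[of j l] ij by (cases "k = l") auto
  qed
  finally show "braket (J i) ((K ** \<sigma> ** dagger K) *v J j) = 0" .
qed

text \<open>The images \<open>U *v J i\<close> are orthonormal and each occupies the single label
  \<open>f i\<close>. Hence \<open>f\<close> is injective, and its inverse is a label map for the
  adjoint.\<close>

lemma incoherent_unitary_dagger:
  assumes J: "orthonormal_basis J" and U: "incoherent_unitary J U"
  shows "incoherent_unitary J (dagger U)"
proof -
  have JJ: "braket (J i) (J j) = (if i = j then 1 else 0)" for i j
    using J by (simp add: orthonormal_basis_def)
  obtain f where f: "\<And>j k. braket (J k) (U *v J j) \<noteq> 0 \<Longrightarrow> k = f j"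
    using incoherent_kraus_map[OF J] U unfolding incoherent_unitary_def by metis
  have UU: "dagger U ** U = mat 1" using U by (simp add: incoherent_unitary_def unitary_op_def)
  have "braket (U *v J i) (U *v J j) = braket (J i) (J j)" for i j
    using braket_dagger[of "dagger U" "J i" "U *v J j"] UU
    by (simp add: matrix_vector_mul_assoc)
  moreover have "braket (U *v J i) (U *v J j) =
      braket (U *v J i) (J (f i)) * braket (J (f i)) (U *v J j)" for i j
  proof -
    have "braket (U *v J i) (U *v J j) = (\<Sum>k\<in>UNIV. braket (U *v J i) (J k) * braket (J k) (U *v J j))"
      by (rule braket_orthonormal_expansion[OF J])
    also have "\<dots> = (\<Sum>k\<in>{f i}. braket (U *v J i) (J k) * braket (J k) (U *v J j))"
    proof (rule sum.mono_neutral_right)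
      have "braket (J k) (U *v J i) = 0" if "k \<noteq> f i" for k using f[of k i] that by blast
      then have "braket (U *v J i) (J k) = 0" if "k \<noteq> f i" for k
        using that braket_commute[of "U *v J i" "J k"] by simp
      then show "\<forall>k\<in>UNIV - {f i}. braket (U *v J i) (J k) * braket (J k) (U *v J j) = 0" by simp
    qed auto
    finally show ?thesis by simp
  qed
  ultimately have prod: "braket (U *v J i) (J (f i)) * braket (J (f i)) (U *v J j) = (if i = j then 1 else 0)"
    for i j by (simp add: JJ)
  \<comment> \<open>The cases \<open>prod[of i i]\<close> and \<open>prod[of j j]\<close> make the
    coefficients at the common label nonzero, while distinct \<open>i\<close> and \<open>j\<close>
    would make their product 0.\<close>
  have inj: "i = j" if "f i = f j" for i j
    using prod[of i i] prod[of j j] prod[of i j] that by (auto split: if_splits)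
  have "k = inv f j" if "braket (J k) (dagger U *v J j) \<noteq> 0" for j k
  proof -
    have "braket (J j) (U *v J k) \<noteq> 0"
      using that by (metis braket_commute braket_dagger complex_cnj_zero)
    then have "j = f k" by (rule f)
    then show ?thesis using inj by (metis injI inv_f_f)
  qed
  then have "incoherent_kraus J (dagger U)" by (rule incoherent_krausI[OF J])
  then show ?thesis using U by (simp add: incoherent_unitary_def unitary_op_def)
qed

lemma component_tensor:
  assumes "orthonormal_basis J"
  shows "component J k ((A \<otimes>\<^sub>o B) *v \<Psi>) =
    (\<Sum>j\<in>UNIV. braket (J k) (A *v J j) *s (B *v component J j \<Psi>))"
proof -
  have "component J k ((A \<otimes>\<^sub>o B) *v \<Psi>) $ b =
      (\<Sum>j\<in>UNIV. braket (J k) (A *v J j) *s (B *v component J j \<Psi>)) $ b" for b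
  proof -
    define t where "t j a c d = cnj (J k $ a) * A $ a $ c * J j $ c * (B $ b $ d * component J j \<Psi> $ d)"
      for j a c d
    have "component J k ((A \<otimes>\<^sub>o B) *v \<Psi>) $ b = (\<Sum>a\<in>UNIV. \<Sum>c\<in>UNIV. \<Sum>d\<in>UNIV. \<Sum>j\<in>UNIV. t j a c d)"
      unfolding t_def
      by (simp add: component_def[of J k] tensor_op_def matrix_vector_mult_def sum_UNIV_pair
          component_expansion[OF assms, of \<Psi>] sum_distrib_left mult_ac)
    also have "\<dots> = (\<Sum>a\<in>UNIV. \<Sum>c\<in>UNIV. \<Sum>j\<in>UNIV. \<Sum>d\<in>UNIV. t j a c d)"
      by (rule sum.cong[OF refl], rule sum.cong[OF refl], rule sum.swap)
    also have "\<dots> = (\<Sum>a\<in>UNIV. \<Sum>j\<in>UNIV. \<Sum>c\<in>UNIV. \<Sum>d\<in>UNIV. t j a c d)"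
      by (rule sum.cong[OF refl], rule sum.swap)
    also have "\<dots> = (\<Sum>j\<in>UNIV. \<Sum>a\<in>UNIV. \<Sum>c\<in>UNIV. \<Sum>d\<in>UNIV. t j a c d)"
      by (rule sum.swap)
    also have "\<dots> = (\<Sum>j\<in>UNIV. braket (J k) (A *v J j) *s (B *v component J j \<Psi>)) $ b"
      unfolding t_def
      by (simp add: braket_def matrix_vector_mult_def sum_distrib_left sum_distrib_right mult_ac)
    finally show ?thesis .
  qed
  then show ?thesis by (simp add: vec_eq_iff)
qed

section \<open>Weight dominance and entropy decrease for pure states\<close>

text \<open>For an orthonormal \<open>J\<close> this applies to \<open>A\<close> the projector onto
  the span of the \<open>J j\<close> with \<open>j \<in> T\<close>. The form through components
  makes the components of the result immediate.\<close>

definition restrict_components ::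
    "('a \<Rightarrow> complex ^ 'a) \<Rightarrow> 'a set \<Rightarrow> complex ^ ('a::finite \<times> 'b::finite) \<Rightarrow> complex ^ ('a \<times> 'b)"
  where "restrict_components J T \<Psi> = (\<chi> x. \<Sum>j\<in>T. J j $ fst x * component J j \<Psi> $ snd x)"

lemma component_restrict_components:
  assumes "orthonormal_basis J"
  shows "component J k (restrict_components J T \<Psi>) = (if k \<in> T then component J k \<Psi> else 0)"
proof -
  have "component J k (restrict_components J T \<Psi>) $ b =
      (\<Sum>j\<in>T. braket (J k) (J j) * component J j \<Psi> $ b)" for b
    unfolding component_def[of J k] restrict_components_def braket_def vec_lambda_beta fst_conv snd_conv
      sum_distrib_left sum_distrib_right
    by (subst sum.swap) (simp add: mult.assoc)
  moreover have "braket (J k) (J j) = (if k = j then 1 else 0)" for j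
    using assms by (simp add: orthonormal_basis_def)
  ultimately show ?thesis
    by (simp add: vec_eq_iff if_distrib if_distribR cong: if_cong)
qed

text \<open>The vectors \<open>K n *v \<Psi>\<close>, stacked over \<open>n\<close>, are the image
  of \<open>\<Psi>\<close> under an isometry.\<close>

lemma kraus_sum_inner:
  fixes K :: "nat \<Rightarrow> 'n::finite op"
  assumes "(\<Sum>n<N. dagger (K n) ** K n) = mat 1"
  shows "(\<Sum>n<N. inner (K n *v \<Psi>) (K n *v \<Phi>)) = inner \<Psi> \<Phi>"
proof -
  have "(\<Sum>n<N. braket (K n *v \<Psi>) (K n *v \<Phi>)) = (\<Sum>n<N. braket \<Psi> ((dagger (K n) ** K n) *v \<Phi>))"
    using braket_dagger[of "dagger (K _)"] by (simp add: matrix_vector_mul_assoc[symmetric])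
  also have "\<dots> = braket \<Psi> \<Phi>"
    using assms by (simp add: braket_sum_right[symmetric] matrix_vector_mult_sum[symmetric])
  finally show ?thesis by (simp add: inner_complex_vec Re_sum[symmetric])
qed

text \<open>
  The part \<open>\<Psi>\<^sub>T\<close> of \<open>\<Psi>\<close> over \<open>T\<close> satisfies \<open>\<langle>\<Psi>\<^sub>T, \<Psi>\<rangle> = \<parallel>\<Psi>\<^sub>T\<parallel>\<^sup>2\<close>, the Kraus map
  preserves this inner product, and it sends \<open>\<Psi>\<^sub>T\<close> into the blocks \<open>f n ` T\<close>.
\<close>

lemma outcome_weight_kraus_dominance:
  fixes A :: "nat \<Rightarrow> 'a::finite op" and B :: "nat \<Rightarrow> 'b::finite op"
  assumes J: "orthonormal_basis J"
    and f: "\<And>n j k. n < N \<Longrightarrow> braket (J k) (A n *v J j) \<noteq> 0 \<Longrightarrow> k = f n j"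
    and complete: "(\<Sum>n<N. dagger (A n \<otimes>\<^sub>o B n) ** (A n \<otimes>\<^sub>o B n)) = mat 1"
  shows "(\<Sum>j\<in>T. outcome_weight J \<Psi> j) \<le>
    (\<Sum>n<N. \<Sum>k\<in>f n ` T. outcome_weight J ((A n \<otimes>\<^sub>o B n) *v \<Psi>) k)"
proof -
  let ?K = "\<lambda>n. A n \<otimes>\<^sub>o B n" and ?X = "restrict_components J T \<Psi>"
  have X: "inner ?X \<Phi> = (\<Sum>j\<in>T. inner (component J j \<Psi>) (component J j \<Phi>))" for \<Phi>
  proof -
    have "inner ?X \<Phi> = (\<Sum>j\<in>UNIV. if j \<in> T then inner (component J j \<Psi>) (component J j \<Phi>) else 0)"
      unfolding inner_component[OF J, of ?X]
      by (intro sum.cong) (auto simp: component_restrict_components[OF J])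
    then show ?thesis by (simp add: sum.If_cases)
  qed
  have XX: "inner ?X ?X = (\<Sum>j\<in>T. outcome_weight J \<Psi> j)"
    unfolding X outcome_weight_def power2_norm_eq_inner
    by (intro sum.cong) (auto simp: component_restrict_components[OF J])
  have XPsi: "inner ?X \<Psi> = (\<Sum>j\<in>T. outcome_weight J \<Psi> j)"
    by (simp add: X outcome_weight_def power2_norm_eq_inner)
  have supp: "component J k (?K n *v ?X) = 0" if "n < N" "k \<notin> f n ` T" for n k
    unfolding component_tensor[OF J] using that f[of n k]
    by (intro sum.neutral) (auto simp: component_restrict_components[OF J])
  \<comment> \<open>Completing the square in each block. Summed over \<open>n\<close>, the left side
    is twice the weight of \<open>T\<close> and the first term on the right is one copy of it, so
    one copy is left to be bounded by the output weights.\<close>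
  have bound: "2 * inner (?K n *v ?X) (?K n *v \<Psi>) \<le>
      inner (?K n *v ?X) (?K n *v ?X) + (\<Sum>k\<in>f n ` T. outcome_weight J (?K n *v \<Psi>) k)"
    if n: "n < N" for n
  proof -
    let ?v = "\<lambda>k. component J k (?K n *v ?X)" and ?w = "\<lambda>k. component J k (?K n *v \<Psi>)"
    have "2 * inner (?K n *v ?X) (?K n *v \<Psi>) = (\<Sum>k\<in>f n ` T. 2 * inner (?v k) (?w k))"
      unfolding inner_component[OF J] sum_distrib_left
      by (rule sum.mono_neutral_right) (auto simp: supp[OF n])
    also have "\<dots> \<le> (\<Sum>k\<in>f n ` T. inner (?v k) (?v k) + outcome_weight J (?K n *v \<Psi>) k)"
    proof (rule sum_mono)
      fix k
      have "0 \<le> inner (?v k - ?w k) (?v k - ?w k)" by simp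
      then show "2 * inner (?v k) (?w k) \<le> inner (?v k) (?v k) + outcome_weight J (?K n *v \<Psi>) k"
        by (simp add: outcome_weight_def power2_norm_eq_inner inner_diff_left inner_diff_right
            inner_commute)
    qed
    also have "\<dots> \<le> inner (?K n *v ?X) (?K n *v ?X) + (\<Sum>k\<in>f n ` T. outcome_weight J (?K n *v \<Psi>) k)"
      unfolding sum.distrib inner_component[OF J, of "?K n *v ?X"]
      by (intro add_right_mono sum_mono2) auto
    finally show ?thesis .
  qed
  have "2 * inner ?X \<Psi> = (\<Sum>n<N. 2 * inner (?K n *v ?X) (?K n *v \<Psi>))"
    by (simp add: kraus_sum_inner[OF complete] sum_distrib_left[symmetric])
  also have "\<dots> \<le> (\<Sum>n<N. inner (?K n *v ?X) (?K n *v ?X) +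
      (\<Sum>k\<in>f n ` T. outcome_weight J (?K n *v \<Psi>) k))"
    by (intro sum_mono bound) simp
  also have "\<dots> = inner ?X ?X + (\<Sum>n<N. \<Sum>k\<in>f n ` T. outcome_weight J (?K n *v \<Psi>) k)"
    by (simp add: sum.distrib kraus_sum_inner[OF complete])
  finally show ?thesis using XX XPsi by linarith
qed

text \<open>This is the pure-state monotonicity that the convex roof inherits. Homogeneity of
  \<open>outcome_entropy\<close> lets the unnormalised output vectors carry the outcome
  probabilities.\<close>

lemma outcome_entropy_kraus_le:
  fixes A :: "nat \<Rightarrow> 'a::finite op" and B :: "nat \<Rightarrow> 'b::finite op"
  assumes J: "orthonormal_basis J"
    and f: "\<And>n j k. n < N \<Longrightarrow> braket (J k) (A n *v J j) \<noteq> 0 \<Longrightarrow> k = f n j"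
    and complete: "(\<Sum>n<N. dagger (A n \<otimes>\<^sub>o B n) ** (A n \<otimes>\<^sub>o B n)) = mat 1"
    and unit: "norm \<Psi> = 1"
  shows "(\<Sum>n<N. outcome_entropy J ((A n \<otimes>\<^sub>o B n) *v \<Psi>)) \<le> outcome_entropy J \<Psi>"
proof -
  let ?K = "\<lambda>n. A n \<otimes>\<^sub>o B n"
  define p where "p = outcome_weight J \<Psi>"
  define r where "r n = outcome_weight J (?K n *v \<Psi>)" for n
  define q where "q n = (norm (?K n *v \<Psi>))\<^sup>2" for n
  \<comment> \<open>A maximum over the fibre of \<open>k\<close>, not a sum, so that superlevel sets
    of \<open>t n\<close> are images of superlevel sets of \<open>p\<close>. Inserting 0 covers
    empty fibres.\<close>
  define t where "t n k = Max (insert 0 (p ` {j. f n j = k}))" for n k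
  have p0: "0 \<le> p j" for j by (simp add: p_def)
  have r0: "0 \<le> r n k" for n k by (simp add: r_def)
  have p1: "sum p UNIV = 1" using unit by (simp add: p_def sum_outcome_weight[OF J])
  have rq: "(\<Sum>k\<in>UNIV. r n k) = q n" for n by (simp add: r_def q_def sum_outcome_weight[OF J])
  have r_le: "r n k \<le> q n" for n k
    unfolding rq[symmetric] using r0 by (intro member_le_sum) auto
  have q1: "(\<Sum>n<N. q n) = 1"
    using kraus_sum_inner[OF complete, of \<Psi> \<Psi>] unit
    by (simp add: q_def power2_norm_eq_inner) (simp add: power2_norm_eq_inner[symmetric])
  have t0: "0 \<le> t n k" for n k by (simp add: t_def)
  have t_ge: "c \<le> t n k \<longleftrightarrow> k \<in> f n ` {j. c \<le> p j}" if "0 < c" for c n k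
    using that by (auto simp: t_def Max_ge_iff)
  have t_sum: "(\<Sum>k\<in>UNIV. t n k) \<le> 1" for n
  proof -
    have "t n k \<le> (\<Sum>j | j \<in> UNIV \<and> f n j = k. p j)" for k
      unfolding t_def using p0 by (intro Max.boundedI) (auto intro!: sum_nonneg member_le_sum)
    then have "(\<Sum>k\<in>UNIV. t n k) \<le> (\<Sum>k\<in>UNIV. \<Sum>j | j \<in> UNIV \<and> f n j = k. p j)"
      by (rule sum_mono)
    also have "\<dots> = sum p UNIV" by (rule sum.group) auto
    finally show ?thesis using p1 by simp
  qed
  \<comment> \<open>If all weights in the fibre of \<open>k\<close> vanish, so do the components of
    \<open>\<Psi>\<close> there, and nothing is mapped to label \<open>k\<close>.\<close>
  have t_pos: "0 < t n k" if "n < N" "0 < r n k" for n k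
  proof (rule ccontr)
    assume "\<not> 0 < t n k"
    then have "t n k = 0" using t0[of n k] by simp
    moreover have "p j \<le> t n k" if "f n j = k" for j
      unfolding t_def using that by (intro Max_ge) auto
    ultimately have "p j = 0" if "f n j = k" for j using that p0[of j] by force
    then have zero: "component J j \<Psi> = 0" if "f n j = k" for j
      using that by (simp add: p_def outcome_weight_def)
    have "braket (J k) (A n *v J j) *s (B n *v component J j \<Psi>) = 0" for j
      using f[OF \<open>n < N\<close>, of k j] zero[of j]
      by (cases "braket (J k) (A n *v J j) = 0") auto
    then have "component J k (?K n *v \<Psi>) = 0"
      unfolding component_tensor[OF J] by (intro sum.neutral ballI)
    then show False using that by (simp add: r_def outcome_weight_def)
  qed
  have gibbs: "outcome_entropy J (?K n *v \<Psi>) \<le> - (\<Sum>k\<in>UNIV. r n k * log 2 (t n k))" if "n < N" for n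
  proof -
    have "outcome_entropy J (?K n *v \<Psi>) = (\<Sum>k\<in>UNIV. - (r n k * log 2 (r n k / q n)))"
      by (simp add: outcome_entropy_def r_def q_def sum_negf)
    also have "\<dots> \<le> (\<Sum>k\<in>UNIV. - (r n k * log 2 (t n k)) + (t n k * q n - r n k) / ln 2)"
      using r0 t0 r_le t_pos[OF that] by (intro sum_mono gibbs_inequality_term) auto
    also have "\<dots> = - (\<Sum>k\<in>UNIV. r n k * log 2 (t n k)) + ((\<Sum>k\<in>UNIV. t n k) * q n - q n) / ln 2"
      by (simp add: sum.distrib sum_negf sum_divide_distrib[symmetric] sum_subtractf
          sum_distrib_right rq)
    also have "((\<Sum>k\<in>UNIV. t n k) * q n - q n) / ln 2 \<le> 0"
      using mult_right_mono[OF t_sum[of n], of "q n"] by (simp add: q_def divide_le_0_iff)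
    finally show ?thesis by simp
  qed
  \<comment> \<open>Both sums are restricted to positive arguments, where \<open>log 2\<close> is
    monotone. The discarded terms carry weight 0, on the output side by
    \<open>t_pos\<close>.\<close>
  define I where "I = {j. 0 < p j}"
  define L where "L = {(n, k). n < N \<and> 0 < t n k}"
  have L_sub: "L \<subseteq> {..<N} \<times> UNIV" by (auto simp: L_def)
  then have finL: "finite L" by (rule finite_subset) simp
  have sum_I: "(\<Sum>j\<in>I. p j * g j) = (\<Sum>j\<in>UNIV. p j * g j)" for g :: "'a \<Rightarrow> real"
    using p0 by (intro sum.mono_neutral_left) (auto simp: I_def order_less_le)
  have sum_L: "(\<Sum>x\<in>L. r (fst x) (snd x) * g (fst x) (snd x)) = (\<Sum>n<N. \<Sum>k\<in>UNIV. r n k * g n k)"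
    for g :: "nat \<Rightarrow> 'a \<Rightarrow> real"
  proof -
    have "(\<Sum>x\<in>L. r (fst x) (snd x) * g (fst x) (snd x)) =
        (\<Sum>x\<in>{..<N} \<times> UNIV. r (fst x) (snd x) * g (fst x) (snd x))"
    proof (rule sum.mono_neutral_left[OF _ L_sub])
      show "\<forall>x\<in>{..<N} \<times> UNIV - L. r (fst x) (snd x) * g (fst x) (snd x) = 0"
      proof
        fix x assume "x \<in> {..<N} \<times> UNIV - L"
        then have "fst x < N" "\<not> 0 < t (fst x) (snd x)" by (auto simp: L_def)
        then have "r (fst x) (snd x) = 0"
          using t_pos[of "fst x" "snd x"] r0[of "fst x" "snd x"] by linarith
        then show "r (fst x) (snd x) * g (fst x) (snd x) = 0" by simp
      qed
    qed simp
    then show ?thesis by (simp add: sum.cartesian_product case_prod_unfold)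
  qed
  have "(\<Sum>j\<in>I. p j * log 2 (p j)) \<le> (\<Sum>x\<in>L. r (fst x) (snd x) * log 2 (t (fst x) (snd x)))"
  proof (rule stochastic_dominance_sum_mono[where x = p and G = "log 2" and y = "\<lambda>x. t (fst x) (snd x)"
        and u = p and v = "\<lambda>x. r (fst x) (snd x)"])
    show "finite I" "finite L" using finL by auto
    show "mono_on (p ` I \<union> (\<lambda>x. t (fst x) (snd x)) ` L) (log 2)"
      by (intro mono_onI) (auto simp: I_def L_def)
    show "sum p I = (\<Sum>x\<in>L. r (fst x) (snd x))"
      using sum_I[of "\<lambda>_. 1"] sum_L[of "\<lambda>_ _. 1"] p1 q1 rq by simp
  next
    fix c assume "c \<in> p ` I \<union> (\<lambda>x. t (fst x) (snd x)) ` L"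
    then have c: "0 < c" by (auto simp: I_def L_def)
    have "(\<Sum>j\<in>I. p j * of_bool (c \<le> p j)) = (\<Sum>j | c \<le> p j. p j)"
      unfolding sum_I by simp
    \<comment> \<open>Weight dominance with \<open>T\<close> the superlevel set of \<open>p\<close>
      at height \<open>c\<close>.\<close>
    also have "\<dots> \<le> (\<Sum>n<N. \<Sum>k\<in>f n ` {j. c \<le> p j}. r n k)"
      unfolding p_def r_def by (rule outcome_weight_kraus_dominance[OF J f complete])
    also have "\<dots> = (\<Sum>n<N. \<Sum>k\<in>UNIV. r n k * of_bool (c \<le> t n k))"
      by (simp add: t_ge[OF c])
    also have "\<dots> = (\<Sum>x\<in>L. r (fst x) (snd x) * of_bool (c \<le> t (fst x) (snd x)))"
      by (rule sum_L[symmetric])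
    finally show "(\<Sum>j\<in>I. p j * of_bool (c \<le> p j)) \<le>
      (\<Sum>x\<in>L. r (fst x) (snd x) * of_bool (c \<le> t (fst x) (snd x)))" .
  qed
  then have "(\<Sum>j\<in>UNIV. p j * log 2 (p j)) \<le> (\<Sum>n<N. \<Sum>k\<in>UNIV. r n k * log 2 (t n k))"
    unfolding sum_I sum_L[of "\<lambda>n k. log 2 (t n k)"] .
  moreover have "(\<Sum>n<N. outcome_entropy J (?K n *v \<Psi>)) \<le> (\<Sum>n<N. - (\<Sum>k\<in>UNIV. r n k * log 2 (t n k)))"
    by (intro sum_mono gibbs) simp
  ultimately show ?thesis using unit by (simp add: outcome_entropy_def p_def sum_negf)
qed

subsection \<open>The convex roof\<close>

text \<open>Normalising the vectors, with squared norms as probabilities, allows decompositions to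
  be built from unnormalised vectors over any finite index set. By homogeneity the roof value is the
  sum of their entropies.\<close>

lemma pure_decomposition_of_family:
  fixes v :: "'e \<Rightarrow> complex ^ ('a::finite \<times> 'b::finite)"
  assumes J: "orthonormal_basis J" and fin: "finite E"
    and \<rho>: "\<rho> = (\<Sum>e\<in>E. ketbra (v e) (v e))" and total: "(\<Sum>e\<in>E. (norm (v e))\<^sup>2) = 1"
  obtains N p \<Psi> where "pure_decomposition \<rho> N p \<Psi>"
    "(\<Sum>e<N. p e * local_randomness J (\<Psi> e)) = (\<Sum>e\<in>E. outcome_entropy J (v e))"
proof -
  obtain h where h: "bij_betw h {..<card E} E"
    using ex_bij_betw_nat_finite[OF fin] by (auto simp: lessThan_atLeast0)
  define p where "p n = (norm (v (h n)))\<^sup>2" for n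
  \<comment> \<open>A zero vector is replaced by an arbitrary unit vector, which receives
    probability 0.\<close>
  define \<Psi> where "\<Psi> n = (if v (h n) = 0 then axis undefined 1 else (1 / norm (v (h n))) *\<^sub>R v (h n))" for n
  have unit: "norm (\<Psi> n) = 1" for n by (simp add: \<Psi>_def norm_axis_1)
  have v: "v (h n) = norm (v (h n)) *\<^sub>R \<Psi> n" for n by (simp add: \<Psi>_def)
  have "ketbra (v (h n)) (v (h n)) = p n *\<^sub>R ketbra (\<Psi> n) (\<Psi> n)" for n
    by (subst (1 2) v) (simp add: ketbra_scaleR p_def)
  moreover have "\<rho> = (\<Sum>n<card E. ketbra (v (h n)) (v (h n)))"
    unfolding \<rho> by (rule sum.reindex_bij_betw[OF h, symmetric])
  moreover have "(\<Sum>n<card E. p n) = 1"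
    unfolding p_def sum.reindex_bij_betw[OF h, of "\<lambda>e. (norm (v e))\<^sup>2"] by (rule total)
  ultimately have "pure_decomposition \<rho> (card E) p \<Psi>"
    using unit by (simp add: pure_decomposition_def p_def)
  moreover have "p n * local_randomness J (\<Psi> n) = outcome_entropy J (v (h n))" for n
    using outcome_entropy_scaleR[of J "norm (v (h n))" "\<Psi> n"]
    by (simp add: local_randomness_eq_outcome_entropy[OF J unit] p_def v[symmetric])
  then have "(\<Sum>n<card E. p n * local_randomness J (\<Psi> n)) = (\<Sum>e\<in>E. outcome_entropy J (v e))"
    using sum.reindex_bij_betw[OF h, of "\<lambda>e. outcome_entropy J (v e)"] by simp
  ultimately show thesis by (rule that)
qed

lemma roof_value_nonneg:
  assumes "orthonormal_basis J" "pure_decomposition \<rho> N p \<Psi>"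
  shows "0 \<le> (\<Sum>e<N. p e * local_randomness J (\<Psi> e))"
proof (rule sum_nonneg)
  fix e assume "e \<in> {..<N}"
  then have "0 \<le> p e" "norm (\<Psi> e) = 1" using assms(2) by (auto simp: pure_decomposition_def)
  then show "0 \<le> p e * local_randomness J (\<Psi> e)"
    by (simp add: local_randomness_eq_outcome_entropy[OF assms(1)] outcome_entropy_nonneg[OF assms(1)])
qed

lemma BD_le_roof_value:
  assumes "orthonormal_basis J" "pure_decomposition \<rho> N p \<Psi>"
  shows "BD J \<rho> \<le> (\<Sum>e<N. p e * local_randomness J (\<Psi> e))"
  unfolding BD_def
proof (rule cInf_lower)
  show "bdd_below {(\<Sum>e<N. p e * local_randomness J (\<Psi> e)) | N p \<Psi>. pure_decomposition \<rho> N p \<Psi>}"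
    using roof_value_nonneg[OF assms(1)] by (intro bdd_belowI[of _ 0]) auto
next
  show "(\<Sum>e<N. p e * local_randomness J (\<Psi> e)) \<in>
      {(\<Sum>e<N. p e * local_randomness J (\<Psi> e)) | N p \<Psi>. pure_decomposition \<rho> N p \<Psi>}"
    by (intro CollectI exI conjI, rule refl, rule assms(2))
qed

text \<open>The given decomposition makes the set of roof values nonempty, so that its real infimum
  is a greatest lower bound.\<close>

lemma BD_greatest:
  assumes "pure_decomposition \<rho> N0 p0 \<Psi>0"
    and "\<And>N p \<Psi>. pure_decomposition \<rho> N p \<Psi> \<Longrightarrow>
      c \<le> (\<Sum>e<N. p e * local_randomness J (\<Psi> e))"
  shows "c \<le> BD J \<rho>"
  unfolding BD_def
proof (rule cInf_greatest)
  have "(\<Sum>e<N0. p0 e * local_randomness J (\<Psi>0 e)) \<in>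
      {(\<Sum>e<N. p e * local_randomness J (\<Psi> e)) | N p \<Psi>. pure_decomposition \<rho> N p \<Psi>}"
    by (intro CollectI exI conjI, rule refl, rule assms(1))
  then show "{(\<Sum>e<N. p e * local_randomness J (\<Psi> e)) | N p \<Psi>. pure_decomposition \<rho> N p \<Psi>} \<noteq> {}"
    by (metis emptyE)
next
  fix x assume "x \<in> {(\<Sum>e<N. p e * local_randomness J (\<Psi> e)) | N p \<Psi>. pure_decomposition \<rho> N p \<Psi>}"
  then show "c \<le> x" using assms(2) by clarsimp
qed

text \<open>In a factorisation of \<open>\<rho>\<close> into rank-one terms the squared norms add up
  to the trace, which is 1.\<close>

lemma density_op_pure_decomposition:
  fixes \<rho> :: "('a::finite \<times> 'b::finite) op"
  assumes J: "orthonormal_basis (J :: 'a \<Rightarrow> complex ^ 'a)" and \<rho>: "density_op \<rho>"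
  obtains N p \<Psi> where "pure_decomposition \<rho> N p \<Psi>"
proof -
  have "dagger \<rho> = \<rho>" "\<And>v. 0 \<le> Re (braket v (\<rho> *v v))"
    using \<rho> by (auto simp: density_op_def)
  then obtain v :: "'a \<times> 'b \<Rightarrow> complex ^ ('a \<times> 'b)" where v: "\<rho> = (\<Sum>x\<in>UNIV. ketbra (v x) (v x))"
    by (rule psd_decomposition)
  have "complex_of_real (\<Sum>x\<in>UNIV. (norm (v x))\<^sup>2) = (\<Sum>x\<in>UNIV. trace (ketbra (v x) (v x)))"
    by (simp add: trace_ketbra)
  also have "\<dots> = trace \<rho>"
    unfolding v trace_def sum_component by (rule sum.swap)
  also have "\<dots> = complex_of_real 1" using \<rho> by (simp add: density_op_def)
  finally have "(\<Sum>x\<in>UNIV. (norm (v x))\<^sup>2) = 1" unfolding of_real_eq_iff .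
  from pure_decomposition_of_family[OF J finite v this] that show thesis by blast
qed

section \<open>Monotonicity under SQI operations\<close>

text \<open>Applying every Kraus operator to every vector of a decomposition of
  \<open>\<rho>\<close> decomposes \<open>\<Lambda> \<rho>\<close>, and pure-state monotonicity
  bounds its roof value by that of the original. So \<open>BD J (\<Lambda> \<rho>)\<close> is a
  lower bound for all roof values of \<open>\<rho>\<close>.\<close>

lemma BD_SQI_le:
  fixes \<rho> :: "('a::finite \<times> 'b::finite) op"
  assumes J: "orthonormal_basis J" and \<Lambda>: "SQI_operation J \<Lambda>" and \<rho>: "density_op \<rho>"
  shows "BD J (\<Lambda> \<rho>) \<le> BD J \<rho>"
proof -
  obtain M and A :: "nat \<Rightarrow> 'a op" and B :: "nat \<Rightarrow> 'b op"
    where inc: "\<forall>n<M. incoherent_kraus J (A n)"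
      and one: "(\<Sum>n<M. (dagger (A n) ** A n) \<otimes>\<^sub>o (dagger (B n) ** B n)) = mat 1"
      and \<Lambda>': "\<Lambda> \<rho> = (\<Sum>n<M. (A n \<otimes>\<^sub>o B n) ** \<rho> ** dagger (A n \<otimes>\<^sub>o B n))"
    using \<Lambda> unfolding SQI_operation_def by blast
  let ?K = "\<lambda>n. A n \<otimes>\<^sub>o B n"
  have complete: "(\<Sum>n<M. dagger (?K n) ** ?K n) = mat 1"
    using one by (simp add: dagger_tensor tensor_mult)
  have "\<forall>n. \<exists>g. n < M \<longrightarrow> (\<forall>j k. braket (J k) (A n *v J j) \<noteq> 0 \<longrightarrow> k = g j)"
  proof
    fix n
    show "\<exists>g. n < M \<longrightarrow> (\<forall>j k. braket (J k) (A n *v J j) \<noteq> 0 \<longrightarrow> k = g j)"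
    proof (cases "n < M")
      case True
      then have "incoherent_kraus J (A n)" using inc by blast
      then show ?thesis by (rule incoherent_kraus_map[OF J]) blast
    qed simp
  qed
  from choice[OF this] obtain f
    where f: "\<And>n j k. n < M \<Longrightarrow> braket (J k) (A n *v J j) \<noteq> 0 \<Longrightarrow> k = f n j"
    by blast
  obtain N0 p0 \<Psi>0 where "pure_decomposition \<rho> N0 p0 \<Psi>0"
    using density_op_pure_decomposition[OF J \<rho>] by blast
  then show ?thesis
  proof (rule BD_greatest)
    fix N p \<Psi> assume dec: "pure_decomposition \<rho> N p \<Psi>"
    have p0: "0 \<le> p e" and unit: "norm (\<Psi> e) = 1" if "e < N" for e
      using dec that by (auto simp: pure_decomposition_def)
    have p1: "(\<Sum>e<N. p e) = 1" and \<rho>_eq: "\<rho> = (\<Sum>e<N. p e *\<^sub>R ketbra (\<Psi> e) (\<Psi> e))"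
      using dec by (auto simp: pure_decomposition_def)
    \<comment> \<open>The factor \<open>sqrt (p e)\<close> absorbs the probability, since both
      \<open>ketbra\<close> and \<open>outcome_entropy\<close> scale quadratically.\<close>
    define v where "v = (\<lambda>(e, n). sqrt (p e) *\<^sub>R (?K n *v \<Psi> e))"
    have "\<Lambda> \<rho> = (\<Sum>n<M. \<Sum>e<N. ketbra (v (e, n)) (v (e, n)))"
      unfolding \<Lambda>'
    proof (rule sum.cong[OF refl])
      fix n
      have "?K n ** \<rho> ** dagger (?K n) = (\<Sum>e<N. ?K n ** (p e *\<^sub>R ketbra (\<Psi> e) (\<Psi> e)) ** dagger (?K n))"
        unfolding \<rho>_eq by (simp only: matrix_mult_sum_left matrix_mult_sum_right)
      also have "\<dots> = (\<Sum>e<N. ketbra (v (e, n)) (v (e, n)))"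
      proof (rule sum.cong[OF refl])
        fix e assume "e \<in> {..<N}"
        then have "p e *\<^sub>R ketbra (\<Psi> e) (\<Psi> e) = ketbra (sqrt (p e) *\<^sub>R \<Psi> e) (sqrt (p e) *\<^sub>R \<Psi> e)"
          using p0 by (simp add: ketbra_scaleR)
        moreover have "?K n *v (c *\<^sub>R w) = c *\<^sub>R (?K n *v w)" for c w
          by (simp add: matrix_vector_mult_def vec_eq_iff scaleR_sum_right)
        ultimately show "?K n ** (p e *\<^sub>R ketbra (\<Psi> e) (\<Psi> e)) ** dagger (?K n) = ketbra (v (e, n)) (v (e, n))"
          by (simp add: ketbra_conj v_def)
      qed
      finally show "?K n ** \<rho> ** dagger (?K n) = (\<Sum>e<N. ketbra (v (e, n)) (v (e, n)))" .
    qed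
    also have "\<dots> = (\<Sum>e<N. \<Sum>n<M. ketbra (v (e, n)) (v (e, n)))" by (rule sum.swap)
    finally have \<Lambda>\<rho>: "\<Lambda> \<rho> = (\<Sum>x\<in>{..<N} \<times> {..<M}. ketbra (v x) (v x))"
      by (simp add: sum.cartesian_product)
    have "(\<Sum>x\<in>{..<N} \<times> {..<M}. (norm (v x))\<^sup>2) = (\<Sum>e<N. \<Sum>n<M. (norm (v (e, n)))\<^sup>2)"
      by (simp add: sum.cartesian_product)
    also have "\<dots> = (\<Sum>e<N. p e * (\<Sum>n<M. inner (?K n *v \<Psi> e) (?K n *v \<Psi> e)))"
      using p0 by (intro sum.cong refl)
        (simp add: v_def power_mult_distrib sum_distrib_left power2_norm_eq_inner[symmetric])
    also have "\<dots> = 1"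
      unfolding kraus_sum_inner[OF complete] unfolding power2_norm_eq_inner[symmetric]
      using unit p1 by simp
    finally obtain N' p' \<Psi>' where "pure_decomposition (\<Lambda> \<rho>) N' p' \<Psi>'"
      and val: "(\<Sum>e<N'. p' e * local_randomness J (\<Psi>' e)) =
        (\<Sum>x\<in>{..<N} \<times> {..<M}. outcome_entropy J (v x))"
      using pure_decomposition_of_family[OF J _ \<Lambda>\<rho>] by blast
    then have "BD J (\<Lambda> \<rho>) \<le> (\<Sum>x\<in>{..<N} \<times> {..<M}. outcome_entropy J (v x))"
      using BD_le_roof_value[OF J, of "\<Lambda> \<rho>" N' p' \<Psi>'] by simp
    also have "\<dots> = (\<Sum>e<N. \<Sum>n<M. outcome_entropy J (v (e, n)))"
      by (simp add: sum.cartesian_product)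
    also have "\<dots> = (\<Sum>e<N. p e * (\<Sum>n<M. outcome_entropy J (?K n *v \<Psi> e)))"
      using p0 by (intro sum.cong refl)
        (simp add: v_def outcome_entropy_scaleR sum_distrib_left)
    also have "\<dots> \<le> (\<Sum>e<N. p e * local_randomness J (\<Psi> e))"
      using p0 unit outcome_entropy_kraus_le[OF J f complete]
      by (intro sum_mono mult_left_mono) (auto simp: local_randomness_eq_outcome_entropy[OF J])
    finally show "BD J (\<Lambda> \<rho>) \<le> (\<Sum>e<N. p e * local_randomness J (\<Psi> e))" .
  qed
qed

section \<open>Vanishing on IQ states\<close>

definition product_vector :: "complex ^ 'a \<Rightarrow> complex ^ 'b \<Rightarrow> complex ^ ('a::finite \<times> 'b::finite)"
  where "product_vector u w = (\<chi> x. u $ fst x * w $ snd x)"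

lemma ketbra_product_vector:
  "ketbra (product_vector u w) (product_vector u w) = ketbra u u \<otimes>\<^sub>o ketbra w w"
  by (simp add: ketbra_def product_vector_def tensor_op_def vec_eq_iff mult_ac)

lemma component_product_vector: "component J k (product_vector u w) = braket (J k) u *s w"
  by (simp add: component_def product_vector_def braket_def vec_eq_iff sum_distrib_right mult.assoc)

text \<open>All the weight of such a product vector sits on the single label \<open>j\<close>, so
  its outcome is certain.\<close>

lemma
  assumes J: "orthonormal_basis J"
  shows norm_product_basis_vector: "(norm (product_vector (J j) w))\<^sup>2 = (norm w)\<^sup>2"
    and outcome_entropy_product_basis_vector: "outcome_entropy J (product_vector (J j) w) = 0"
proof -
  have weight: "outcome_weight J (product_vector (J j) w) k = (if k = j then (norm w)\<^sup>2 else 0)" for k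
    using J by (simp add: outcome_weight_def component_product_vector orthonormal_basis_def)
  show *: "(norm (product_vector (J j) w))\<^sup>2 = (norm w)\<^sup>2"
    unfolding sum_outcome_weight[OF J, symmetric] by (simp add: weight)
  show "outcome_entropy J (product_vector (J j) w) = 0"
    unfolding outcome_entropy_def * neg_equal_0_iff_equal
    by (intro sum.neutral ballI) (simp add: weight)
qed

text \<open>Splitting each conditional state of \<open>B\<close> into rank-one terms decomposes
  \<open>\<rho>\<close> into products with basis vectors, which have no local randomness. This
  attains 0, and no roof value is negative.\<close>

lemma BD_IQ_state:
  fixes \<rho> :: "('a::finite \<times> 'b::finite) op"
  assumes J: "orthonormal_basis J" and \<rho>: "IQ_state J \<rho>"
  shows "BD J \<rho> = 0"
proof -
  obtain p :: "'a \<Rightarrow> real" and \<sigma> :: "'a \<Rightarrow> 'b op"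
    where p0: "\<And>j. 0 \<le> p j" and p1: "(\<Sum>j\<in>UNIV. p j) = 1" and \<sigma>: "\<And>j. density_op (\<sigma> j)"
      and \<rho>_eq: "\<rho> = (\<Sum>j\<in>UNIV. p j *\<^sub>R (ketbra (J j) (J j) \<otimes>\<^sub>o \<sigma> j))"
    using \<rho> unfolding IQ_state_def by blast
  have "\<forall>j. \<exists>w :: 'b \<Rightarrow> complex ^ 'b. \<sigma> j = (\<Sum>b\<in>UNIV. ketbra (w b) (w b))"
  proof
    fix j
    show "\<exists>w :: 'b \<Rightarrow> complex ^ 'b. \<sigma> j = (\<Sum>b\<in>UNIV. ketbra (w b) (w b))"
      using \<sigma>[of j] by (auto simp: density_op_def intro: psd_decomposition[of "\<sigma> j"])
  qed
  from choice[OF this] obtain w :: "'a \<Rightarrow> 'b \<Rightarrow> complex ^ 'b"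
    where w: "\<And>j. \<sigma> j = (\<Sum>b\<in>UNIV. ketbra (w j b) (w j b))" by blast
  have w1: "(\<Sum>b\<in>UNIV. (norm (w j b))\<^sup>2) = 1" for j
  proof -
    have "complex_of_real (\<Sum>b\<in>UNIV. (norm (w j b))\<^sup>2) = trace (\<sigma> j)"
      unfolding of_real_sum trace_ketbra[symmetric] w trace_def sum_component by (rule sum.swap)
    also have "\<dots> = complex_of_real 1" using \<sigma> by (simp add: density_op_def)
    finally show ?thesis unfolding of_real_eq_iff .
  qed
  define v where "v = (\<lambda>(j, b). sqrt (p j) *\<^sub>R product_vector (J j) (w j b))"
  have tensor_sum: "X \<otimes>\<^sub>o (\<Sum>b\<in>S. Y b) = (\<Sum>b\<in>S. X \<otimes>\<^sub>o Y b)" for X :: "'a op" and Y :: "'b \<Rightarrow> 'b op" and S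
    by (simp add: tensor_op_def vec_eq_iff sum_distrib_left)
  have "\<rho> = (\<Sum>j\<in>UNIV. \<Sum>b\<in>UNIV. ketbra (v (j, b)) (v (j, b)))"
    unfolding \<rho>_eq w using p0
    by (simp add: v_def ketbra_scaleR ketbra_product_vector tensor_sum scaleR_sum_right)
  then have \<rho>': "\<rho> = (\<Sum>x\<in>UNIV. ketbra (v x) (v x))" by (simp add: sum_UNIV_pair)
  have "(\<Sum>x\<in>UNIV. (norm (v x))\<^sup>2) = (\<Sum>j\<in>UNIV. p j * (\<Sum>b\<in>UNIV. (norm (w j b))\<^sup>2))"
    using p0 by (simp add: sum_UNIV_pair v_def power_mult_distrib norm_product_basis_vector[OF J]
        sum_distrib_left)
  also have "\<dots> = 1" by (simp add: w1 p1)
  finally obtain N q \<Psi> where dec: "pure_decomposition \<rho> N q \<Psi>"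
    and "(\<Sum>e<N. q e * local_randomness J (\<Psi> e)) = (\<Sum>x\<in>UNIV. outcome_entropy J (v x))"
    using pure_decomposition_of_family[OF J finite \<rho>'] by blast
  then have "BD J \<rho> \<le> (\<Sum>x\<in>UNIV. outcome_entropy J (v x))"
    using BD_le_roof_value[OF J dec] by simp
  also have "\<dots> = 0"
    by (simp add: v_def case_prod_unfold outcome_entropy_scaleR
        outcome_entropy_product_basis_vector[OF J])
  finally show ?thesis
    using BD_greatest[OF dec roof_value_nonneg[OF J]] by simp
qed

section \<open>Invariance under local unitaries\<close>

lemma density_op_conj:
  assumes U: "unitary_op U" and \<rho>: "density_op \<rho>"
  shows "density_op (U ** \<rho> ** dagger U)"
proof -
  have "dagger (U ** \<rho> ** dagger U) = U ** \<rho> ** dagger U"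
    using \<rho> by (simp add: dagger_mult density_op_def matrix_mul_assoc)
  moreover have "0 \<le> Re (braket v ((U ** \<rho> ** dagger U) *v v))" for v
    unfolding braket_mult_dagger using \<rho> by (simp add: density_op_def)
  moreover have "trace (U ** \<rho> ** dagger U) = 1"
  proof -
    have "trace (U ** \<rho> ** dagger U) = trace (dagger U ** (U ** \<rho>))"
      by (rule trace_mul_sym)
    then show ?thesis using U \<rho> by (simp add: matrix_mul_assoc unitary_op_def density_op_def)
  qed
  ultimately show ?thesis by (simp add: density_op_def)
qed

lemma unitary_op_tensor:
  assumes "unitary_op U" "unitary_op V"
  shows "unitary_op (U \<otimes>\<^sub>o V)"
  using assms by (simp add: unitary_op_def dagger_tensor tensor_mult tensor_mat_1)

lemma unitary_op_dagger: "unitary_op U \<Longrightarrow> unitary_op (dagger U)"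
  by (simp add: unitary_op_def)

text \<open>The conjugation is an SQI operation with a single Kraus term.\<close>

lemma BD_unitary_conj_le:
  assumes "orthonormal_basis J" "incoherent_unitary J U" "unitary_op V" "density_op \<rho>"
  shows "BD J ((U \<otimes>\<^sub>o V) ** \<rho> ** dagger (U \<otimes>\<^sub>o V)) \<le> BD J \<rho>"
proof -
  have "SQI_operation J (\<lambda>\<rho>. (U \<otimes>\<^sub>o V) ** \<rho> ** dagger (U \<otimes>\<^sub>o V))"
    unfolding SQI_operation_def
    by (rule exI[of _ 1], rule exI[of _ "\<lambda>_. U"], rule exI[of _ "\<lambda>_. V"])
      (use assms in \<open>simp add: incoherent_unitary_def unitary_op_def tensor_mat_1\<close>)
  from BD_SQI_le[OF assms(1) this assms(4)] show ?thesis .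
qed

text \<open>For the reverse inequality the same bound is applied to the adjoint unitaries, which
  undo the conjugation.\<close>

lemma BD_unitary_conj:
  assumes J: "orthonormal_basis J" and U: "incoherent_unitary J U" and V: "unitary_op V"
    and \<rho>: "density_op \<rho>"
  shows "BD J ((U \<otimes>\<^sub>o V) ** \<rho> ** dagger (U \<otimes>\<^sub>o V)) = BD J \<rho>"
proof (rule antisym)
  show "BD J ((U \<otimes>\<^sub>o V) ** \<rho> ** dagger (U \<otimes>\<^sub>o V)) \<le> BD J \<rho>"
    by (rule BD_unitary_conj_le[OF assms])
next
  let ?W = "U \<otimes>\<^sub>o V" and ?W' = "dagger U \<otimes>\<^sub>o dagger V"
  have W: "unitary_op ?W"
    using U V by (simp add: unitary_op_tensor incoherent_unitary_def)
  have "?W' ** (?W ** \<rho> ** dagger ?W) ** dagger ?W' = (dagger ?W ** ?W) ** \<rho> ** (dagger ?W ** ?W)"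
    by (simp add: dagger_tensor matrix_mul_assoc)
  also have "\<dots> = \<rho>" using W by (simp add: unitary_op_def)
  finally have "?W' ** (?W ** \<rho> ** dagger ?W) ** dagger ?W' = \<rho>" .
  then show "BD J \<rho> \<le> BD J (?W ** \<rho> ** dagger ?W)"
    using BD_unitary_conj_le[OF J incoherent_unitary_dagger[OF J U] unitary_op_dagger[OF V]
        density_op_conj[OF W \<rho>]] by simp
qed

theorem mainTheorem6:
  fixes J :: "'a::finite \<Rightarrow> complex ^ 'a"
  assumes "orthonormal_basis J"
  shows "basis_dependent_discord_measure J
           (BD J :: ('a \<times> 'b::finite) op \<Rightarrow> real)"
  unfolding basis_dependent_discord_measure_def
proof (intro conjI allI impI)
  fix \<rho> :: "('a \<times> 'b) op"
  assume "IQ_state J \<rho>"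
  then show "BD J \<rho> = 0" by (rule BD_IQ_state[OF assms])
next
  fix \<Lambda> :: "('a \<times> 'b) op \<Rightarrow> ('a \<times> 'b) op" and \<rho> :: "('a \<times> 'b) op"
  assume "SQI_operation J \<Lambda> \<and> density_op \<rho>"
  then show "BD J (\<Lambda> \<rho>) \<le> BD J \<rho>" using BD_SQI_le[OF assms, of \<Lambda> \<rho>] by simp
next
  fix U :: "'a op" and V :: "'b op" and \<rho> :: "('a \<times> 'b) op"
  assume "incoherent_unitary J U \<and> unitary_op V \<and> density_op \<rho>"
  then show "BD J ((U \<otimes>\<^sub>o V) ** \<rho> ** dagger (U \<otimes>\<^sub>o V)) = BD J \<rho>"
    using BD_unitary_conj[OF assms, of U V \<rho>] by simp
qed

end
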